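(* Let $G=(V,D,B)$ be a mixed graph and let $(Y_v : v\in V)$ be a family of subsets of $V$. Suppose that for each node $v\in V$ the set $Y_v$ satisfies the half-trek criterion with respect to $v$, and that there is a total ordering $\prec$ on $V$ such that $w\prec v$ whenever $w\in Y_v\cap \mathrm{htr}(v)$. Then $G$ is rationally identifiable.
   Context: A mixed graph is a triple $G=(V,D,B)$ with $V=[m]=\{1,\dots,m\}$, $D\subseteq V\times V$ a set of directed edges, written $v\to w$, and $B\subseteq V\times V$ a symmetric set of bidirected edges, written $v\leftrightarrow w$ ($v\leftrightarrow w\in B$ iff $w\leftrightarrow v\in B$); there are no self-loops $v\to v$ or $v\leftrightarrow v$. $G$ is acyclic if $(V,D)$ contains no directed cycle. Write $\mathrm{pa}(v)=\{w: w\to v\in D\}$ and $\mathrm{sib}(v)=\{w : w\leftrightarrow v\in B\}$. Let $\mathbb{R}^D$ be the set of real $m\times m$ matrices $\Lambda=(\lambda_{vw})$ with $\lambda_{vw}=0$ whenever $v\to w\notin D$, and $\mathbb{R}^D_{\mathrm{reg}}$ the subset with $I-\Lambda$ invertible. Let $\mathrm{PD}(B)$ be the set of positive definite symmetric $m\times m$ matrices $\Omega=(\omega_{vw})$ with $\omega_{vw}=0$ whenever $v\neq w$ and $v\leftrightarrow w\notin B$. Put $\Theta=\mathbb{R}^D_{\mathrm{reg}}\times\mathrm{PD}(B)$ and $\phi_G(\Lambda,\Omega)=(I-\Lambda)^{-T}\Omega(I-\Lambda)^{-1}$. An algebraic subset of $\Theta$ is the set of points of $\Theta$ where a family of polynomials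 in the entries of $(\Lambda,\Omega)$ vanishes; it is proper if it is not all of $\Theta$. $G$ is rationally identifiable if there exist a proper algebraic subset $W\subset\Theta$ and a rational map $\psi$ with $\psi(\phi_G(\Lambda,\Omega))=(\Lambda,\Omega)$ for all $(\Lambda,\Omega)\in\Theta\setminus W$. Treks: a path is a sequence of edges of $D\cup B$ connecting consecutive nodes; it need not be simple and directed edges may be traversed in either direction. A trek from $v$ to $w$ is a path of the form $v=v^L_l\leftarrow\cdots\leftarrow v^L_1\leftarrow v^L_0\leftrightarrow v^R_0\to v^R_1\to\cdots\to v^R_r=w$ (with $\mathrm{Left}(\pi)=\{v^L_0,\dots,v^L_l\}$, $\mathrm{Right}(\pi)=\{v^R_0,\dots,v^R_r\}$), or of the form $v=v^L_l\leftarrow\cdots\leftarrow v^L_1\leftarrow v^T\to v^R_1\to\cdots\to v^R_r=w$ with $l,r\ge 0$ (with $\mathrm{Left}(\pi)=\{v^T,v^L_1,\dots,v^L_l\}$, $\mathrm{Right}(\pi)=\{v^T,v^R_1,\dots,v^R_r\}$; when $l=r=0$ this is the trivial trek at $v^T$). $v$ is the source and $w$ the target. A half-trek is a trek with $|\mathrm{Left}(\pi)|=1$, i.e. a path of the form $v\leftrightarrow w_0\to w_1\to\cdots\to w_r$ or $v\to w_1\to\cdots\to w_r$ (or trivial). A set of $n$ treks $\Pi=\{\pi_1,\dots,\pi_n\}$ whose sources $x_1,\dots,x_n$ are distinct and whose targets $y_1,\dots,y_n$ are distinct is a system of treks from $X=\{x_i\}$ to $Y=\{y_i\}$; it is a system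 of half-treks if each $\pi_i$ is a half-trek. $\Pi$ has no sided intersection if $\mathrm{Left}(\pi_i)\cap\mathrm{Left}(\pi_j)=\emptyset=\mathrm{Right}(\pi_i)\cap\mathrm{Right}(\pi_j)$ for all $i\ne j$. $\mathrm{htr}(v)$ is the set of nodes $w\in V\setminus(\{v\}\cup\mathrm{sib}(v))$ such that there is a half-trek from $v$ to $w$. A set $Y\subseteq V$ satisfies the half-trek criterion with respect to $v$ if (i) $|Y|=|\mathrm{pa}(v)|$, (ii) $Y\cap(\{v\}\cup\mathrm{sib}(v))=\emptyset$, and (iii) there is a system of half-treks with no sided intersection from $Y$ to $\mathrm{pa}(v)$. *)

theory Defs
  imports "HOL-Analysis.Analysis"
begin

text \<open>Nodes of the mixed graph are the elements of a finite type 'n (playing the role of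
  V = [m]). D is the set of directed edges (v,w) meaning v -> w; B the set of bidirected
  edges (v,w) meaning v <-> w.\<close>

definition mixed_graph :: "('n::finite \<times> 'n) set \<Rightarrow> ('n \<times> 'n) set \<Rightarrow> bool" where
  "mixed_graph D B \<longleftrightarrow> (\<forall>v. (v,v) \<notin> D) \<and> (\<forall>v. (v,v) \<notin> B) \<and> sym B"

definition pa :: "('n \<times> 'n) set \<Rightarrow> 'n \<Rightarrow> 'n set" where
  "pa D v = {w. (w,v) \<in> D}"

definition sib :: "('n \<times> 'n) set \<Rightarrow> 'n \<Rightarrow> 'n set" where
  "sib B v = {w. (w,v) \<in> B}"

text \<open>A half-trek from v to w, represented by its source v and the list R of the nodes
  of its right side Right(pi) in order (Left(pi) = {v}). Either
  v -> w1 -> ... -> wr  (R = [v,w1,...,wr], trivial trek if r = 0), or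
  v <-> w0 -> w1 -> ... -> wr  (R = [w0,...,wr]).\<close>

definition is_half_trek :: "('n \<times> 'n) set \<Rightarrow> ('n \<times> 'n) set \<Rightarrow> 'n \<Rightarrow> 'n \<Rightarrow> 'n list \<Rightarrow> bool" where
  "is_half_trek D B v w R \<longleftrightarrow>
     R \<noteq> [] \<and> successively (\<lambda>a b. (a,b) \<in> D) R \<and> last R = w \<and>
     (hd R = v \<or> (v, hd R) \<in> B)"

definition htr :: "('n \<times> 'n) set \<Rightarrow> ('n \<times> 'n) set \<Rightarrow> 'n \<Rightarrow> 'n set" where
  "htr D B v = {w. w \<notin> insert v (sib B v) \<and> (\<exists>R. is_half_trek D B v w R)}"

text \<open>A system of half-treks with no sided intersection from Y to P: a bijection
  sigma from Y to P (sources distinct, targets distinct) and half-treks R y from y to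
  sigma y. Left sides are the singletons {y}, automatically disjoint; right sides must be
  pairwise disjoint.\<close>

definition half_trek_system_nsi ::
  "('n \<times> 'n) set \<Rightarrow> ('n \<times> 'n) set \<Rightarrow> 'n set \<Rightarrow> 'n set \<Rightarrow> bool" where
  "half_trek_system_nsi D B Y P \<longleftrightarrow>
     (\<exists>\<sigma> R. bij_betw \<sigma> Y P \<and> (\<forall>y\<in>Y. is_half_trek D B y (\<sigma> y) (R y)) \<and>
        (\<forall>y\<in>Y. \<forall>y'\<in>Y. y \<noteq> y' \<longrightarrow> set (R y) \<inter> set (R y') = {}))"

definition HTC :: "('n::finite \<times> 'n) set \<Rightarrow> ('n \<times> 'n) set \<Rightarrow> 'n set \<Rightarrow> 'n \<Rightarrow> bool" where
  "HTC D B Y v \<longleftrightarrow>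
     card Y = card (pa D v) \<and> Y \<inter> insert v (sib B v) = {} \<and>
     half_trek_system_nsi D B Y (pa D v)"

definition supported_on :: "('n \<times> 'n) set \<Rightarrow> real^'n^'n \<Rightarrow> bool" where
  "supported_on D \<Lambda> \<longleftrightarrow> (\<forall>v w. (v,w) \<notin> D \<longrightarrow> \<Lambda> $ v $ w = 0)"

definition PD_B :: "('n \<times> 'n) set \<Rightarrow> (real^'n^'n) set" where
  "PD_B B = {\<Omega>. transpose \<Omega> = \<Omega> \<and> (\<forall>x::real^'n. x \<noteq> 0 \<longrightarrow> x \<bullet> (\<Omega> *v x) > 0) \<and>
                (\<forall>v w. v \<noteq> w \<and> (v,w) \<notin> B \<longrightarrow> \<Omega> $ v $ w = 0)}"

definition Theta :: "('n::finite \<times> 'n) set \<Rightarrow> ('n \<times> 'n) set \<Rightarrow> ((real^'n^'n) \<times> (real^'n^'n)) set" where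
  "Theta D B = {(\<Lambda>, \<Omega>). supported_on D \<Lambda> \<and> invertible (mat 1 - \<Lambda>) \<and> \<Omega> \<in> PD_B B}"

definition phiG :: "(real^'n::finite^'n) \<times> (real^'n^'n) \<Rightarrow> real^'n^'n" where
  "phiG p = (case p of (\<Lambda>, \<Omega>) \<Rightarrow>
     transpose (matrix_inv (mat 1 - \<Lambda>)) ** \<Omega> ** matrix_inv (mat 1 - \<Lambda>))"

inductive poly_fun :: "(('v \<Rightarrow> real) \<Rightarrow> real) \<Rightarrow> bool" where
  pf_const: "poly_fun (\<lambda>x. c)"
| pf_var: "poly_fun (\<lambda>x. x i)"
| pf_add: "poly_fun f \<Longrightarrow> poly_fun g \<Longrightarrow> poly_fun (\<lambda>x. f x + g x)"
| pf_mult: "poly_fun f \<Longrightarrow> poly_fun g \<Longrightarrow> poly_fun (\<lambda>x. f x * g x)"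

definition param_coords :: "(real^'n^'n) \<times> (real^'n^'n) \<Rightarrow> ('n \<times> 'n) + ('n \<times> 'n) \<Rightarrow> real" where
  "param_coords p k = (case k of Inl (i,j) \<Rightarrow> fst p $ i $ j | Inr (i,j) \<Rightarrow> snd p $ i $ j)"

definition mat_coords :: "real^'n^'n \<Rightarrow> 'n \<times> 'n \<Rightarrow> real" where
  "mat_coords S k = S $ fst k $ snd k"

definition algebraic_subset_of ::
  "((real^'n^'n) \<times> (real^'n^'n)) set \<Rightarrow> ((real^'n^'n) \<times> (real^'n^'n)) set \<Rightarrow> bool" where
  "algebraic_subset_of W T \<longleftrightarrow>
     (\<exists>F. (\<forall>f\<in>F. poly_fun f) \<and> W = {p\<in>T. \<forall>f\<in>F. f (param_coords p) = 0})"

definition rationally_identifiable :: "('n::finite \<times> 'n) set \<Rightarrow> ('n \<times> 'n) set \<Rightarrow> bool" where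
  "rationally_identifiable D B \<longleftrightarrow>
     (\<exists>W num den. algebraic_subset_of W (Theta D B) \<and> W \<noteq> Theta D B \<and>
        (\<forall>k. poly_fun (num k) \<and> poly_fun (den k)) \<and>
        (\<forall>p \<in> Theta D B - W. \<forall>k.
            den k (mat_coords (phiG p)) \<noteq> 0 \<and>
            num k (mat_coords (phiG p)) / den k (mat_coords (phiG p)) = param_coords p k))"

end

theory Submission
  imports Defs "HOL-Computational_Algebra.Polynomial"
begin

text \<open>Write \<open>\<Sigma> = phiG (\<Lambda>, \<Omega>)\<close>. The columns of \<open>\<Lambda>\<close> are recovered one node at a time along \<open>prec\<close>: for
  \<open>y \<in> Y v\<close> the entry \<open>(y, v)\<close> of \<open>(I - \<Lambda>)\<^sup>T \<Sigma> (I - \<Lambda>) = \<Omega>\<close> vanishes, and if \<open>y \<notin> htr v\<close> then so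
  does that of \<open>\<Sigma> (I - \<Lambda>)\<close>. This is a square linear system for column \<open>v\<close> of \<open>\<Lambda>\<close> whose coefficients
  involve only \<open>\<Sigma>\<close> and columns already found, so Cramer's rule applies wherever its determinant is
  nonzero. That determinant is, up to powers of \<open>det (I - \<Lambda>)\<close>, a polynomial in the parameters, so it
  suffices to find one point, not necessarily with \<open>\<Omega>\<close> positive definite, where it does not vanish.
  Such a 0/1 point is built by induction on the total length of the half-trek system: as long as some
  target \<open>p\<close> is not a source, either the last directed edge into \<open>p\<close> is removed, or the half-trek is
  \<open>y \<leftrightarrow> p\<close> and is removed as a whole; once the targets are the sources, \<open>\<Lambda> = 0\<close> and \<open>\<Omega>\<close> the identity on the sources work.\<close>

subsection \<open>A parameter point from a half-trek system\<close>

text \<open>Put \<open>x = (I - \<Lambda>)\<^sup>-\<^sup>1 c\<close> with \<open>c\<close> supported on \<open>P\<close>, and \<open>w = (I - \<Lambda>\<^sub>C)\<^sup>-\<^sup>T S x\<close>, where \<open>\<Lambda>\<^sub>C\<close> keeps only the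
  entries of \<open>\<Lambda>\<close> in \<open>C\<close>. The definition says that the \<open>Y \<times> P\<close> block of \<open>(I - \<Lambda>\<^sub>C)\<^sup>-\<^sup>T S (I - \<Lambda>)\<^sup>-\<^sup>1\<close> has
  trivial kernel. Masking by \<open>C\<close> treats rows of \<open>\<Omega> (I - \<Lambda>)\<^sup>-\<^sup>1\<close> and of \<open>\<Sigma>\<close> uniformly; the induction
  below needs all masks at once.\<close>

definition trivial_kernel :: "('n::finite \<Rightarrow> 'n \<Rightarrow> real) \<Rightarrow> ('n \<Rightarrow> 'n \<Rightarrow> real) \<Rightarrow> ('n \<times> 'n) set \<Rightarrow> 'n set \<Rightarrow> 'n set \<Rightarrow> bool"
  where "trivial_kernel \<Lambda> S C Y P \<longleftrightarrow>
    (\<forall>x w. (\<forall>i. i \<notin> P \<longrightarrow> x i = (\<Sum>j\<in>UNIV. \<Lambda> i j * x j)) \<longrightarrow>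
      (\<forall>j. w j = (\<Sum>i\<in>UNIV. of_bool ((i,j) \<in> C) * \<Lambda> i j * w i) + (\<Sum>i\<in>UNIV. S j i * x i)) \<longrightarrow>
      (\<forall>y\<in>Y. w y = 0) \<longrightarrow> (\<forall>i. x i = 0 \<and> w i = 0))"

lemma trivial_kernelD:
  assumes "trivial_kernel \<Lambda> S C Y P"
    and "\<And>i. i \<notin> P \<Longrightarrow> x i = (\<Sum>j\<in>UNIV. \<Lambda> i j * x j)"
    and "\<And>j. w j = (\<Sum>i\<in>UNIV. of_bool ((i,j) \<in> C) * \<Lambda> i j * w i) + (\<Sum>i\<in>UNIV. S j i * x i)"
    and "\<And>y. y \<in> Y \<Longrightarrow> w y = 0"
  shows "x i = 0" "w i = 0"
  using assms unfolding trivial_kernel_def by blast+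

lemma sum_upd_isolated:
  fixes f :: "'n::finite \<Rightarrow> real"
  assumes "f p = 0"
  shows "(\<Sum>i\<in>UNIV. f i * (if i = p then c else x i)) = (\<Sum>i\<in>UNIV. f i * x i)"
  by (rule sum.cong) (auto simp: assms)

text \<open>Row operations with row \<open>y\<close> have the effect of removing the edges out of \<open>y\<close> from the mask.\<close>

lemma trivial_kernel_add_bidirected:
  assumes sep: "trivial_kernel \<Lambda> S (C - {y} \<times> UNIV) (Y - {y}) (P - {p})"
    and iso: "\<And>i. \<Lambda> p i = 0" "\<And>i. \<Lambda> i p = 0" "\<And>i. S p i = 0" "\<And>i. S i p = 0"
    and yp: "y \<in> Y" "p \<in> P" "p \<notin> Y"
  shows "trivial_kernel \<Lambda> (\<lambda>i j. S i j + of_bool (i = y \<and> j = p \<or> i = p \<and> j = y)) C Y P"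
  unfolding trivial_kernel_def
proof (intro allI impI)
  fix x w i
  assume x: "\<forall>i. i \<notin> P \<longrightarrow> x i = (\<Sum>j\<in>UNIV. \<Lambda> i j * x j)"
    and w: "\<forall>j. w j = (\<Sum>i\<in>UNIV. of_bool ((i,j) \<in> C) * \<Lambda> i j * w i) +
              (\<Sum>i\<in>UNIV. (S j i + of_bool (j = y \<and> i = p \<or> j = p \<and> i = y)) * x i)"
    and w0: "\<forall>y\<in>Y. w y = 0"
  have ne: "y \<noteq> p" using yp by auto
  \<comment> \<open>The new edge adds \<open>x p\<close> to the equation for \<open>w\<close> at
    \<open>y\<close> and \<open>x y\<close> to the one at \<open>p\<close>. Absorbing these terms
    into \<open>w'\<close> restores the old equations; \<open>w' y\<close> may then be nonzero
    although \<open>w y = 0\<close>, which is why the mask must drop the edges out of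
    \<open>y\<close>.\<close>
  define x' where "x' = x(p := 0)"
  define w' where "w' = w(y := - x p, p := w p - x y)"
  have S: "(\<Sum>i\<in>UNIV. (S j i + of_bool (j = y \<and> i = p \<or> j = p \<and> i = y)) * x i)
      = (\<Sum>i\<in>UNIV. S j i * x' i) + of_bool (j = y) * x p + of_bool (j = p) * x y" for j
  proof -
    have "(\<Sum>i\<in>UNIV. (S j i + of_bool (j = y \<and> i = p \<or> j = p \<and> i = y)) * x i)
      = (\<Sum>i\<in>UNIV. S j i * x i) + (\<Sum>i\<in>UNIV. of_bool (j = y \<and> i = p \<or> j = p \<and> i = y) * x i)"
      by (simp add: distrib_right sum.distrib)
    moreover have "(\<Sum>i\<in>UNIV. of_bool (j = y \<and> i = p \<or> j = p \<and> i = y) * x i)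
        = of_bool (j = y) * x p + of_bool (j = p) * x y"
    proof -
      have "of_bool (j = y \<and> i = p \<or> j = p \<and> i = y) * x i =
         (if i = p then of_bool (j = y) * x p else 0) + (if i = y then of_bool (j = p) * x y else 0)" for i
        using ne by auto
      then show ?thesis by (simp add: sum.distrib)
    qed
    ultimately show ?thesis by (simp add: x'_def sum_upd_isolated iso)
  qed
  have L: "(\<Sum>i\<in>UNIV. of_bool ((i,j) \<in> C) * \<Lambda> i j * w i) =
      (\<Sum>i\<in>UNIV. of_bool ((i,j) \<in> C - {y} \<times> UNIV) * \<Lambda> i j * w' i)" for j
    by (rule sum.cong) (use w0 yp iso in \<open>auto simp: w'_def\<close>)
  have x'eq: "x' i = (\<Sum>j\<in>UNIV. \<Lambda> i j * x' j)" if "i \<notin> P - {p}" for i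
    using x[rule_format, of i] that by (cases "i = p") (auto simp: x'_def sum_upd_isolated iso)
  have w'eq: "w' j = (\<Sum>i\<in>UNIV. of_bool ((i,j) \<in> C - {y} \<times> UNIV) * \<Lambda> i j * w' i) + (\<Sum>i\<in>UNIV. S j i * x' i)" for j
  proof -
    have "w j = (\<Sum>i\<in>UNIV. of_bool ((i,j) \<in> C - {y} \<times> UNIV) * \<Lambda> i j * w' i) + (\<Sum>i\<in>UNIV. S j i * x' i)
      + of_bool (j = y) * x p + of_bool (j = p) * x y"
      using w[rule_format, of j] unfolding S L by simp
    moreover have "w' j = w j - of_bool (j = y) * x p - of_bool (j = p) * x y"
      using w0 yp by (auto simp: w'_def)
    ultimately show ?thesis by simp
  qed
  have w'0: "w' a = 0" if "a \<in> Y - {y}" for a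
    using that w0 yp by (auto simp: w'_def)
  have x'0: "x' i = 0" and w'0: "w' i = 0" for i
    using trivial_kernelD[OF sep x'eq w'eq w'0] by auto
  have "x p = 0" using w'0[of y] ne by (simp add: w'_def)
  then have x0: "x i = 0" for i using x'0[of i] by (auto simp: x'_def split: if_splits)
  have "w i = 0"
    using w'0[of i] x0 w0 yp by (auto simp: w'_def split: if_splits)
  with x0 show "x i = 0 \<and> w i = 0" by simp
qed

text \<open>As \<open>q \<notin> P\<close>, the equation for \<open>x\<close> at \<open>q\<close> is
  now imposed, but with the new edge it merely determines \<open>x p\<close>; so \<open>p\<close>
  replaces \<open>q\<close> as a free coordinate. In the equations for \<open>w\<close> the edge is
  felt only at \<open>p\<close>, which lies outside \<open>Y\<close> and feeds no other
  node.\<close>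

lemma trivial_kernel_add_directed:
  assumes sep: "trivial_kernel \<Lambda> S C Y (insert q (P - {p}))"
    and iso: "\<And>i. \<Lambda> p i = 0" "\<And>i. \<Lambda> i p = 0" "\<And>i. S p i = 0" "\<And>i. S i p = 0"
    and p: "p \<in> P" "p \<notin> Y" "q \<noteq> p" "q \<notin> P"
  shows "trivial_kernel (\<lambda>i j. \<Lambda> i j + of_bool (i = q \<and> j = p)) S C Y P"
  unfolding trivial_kernel_def
proof (intro allI impI)
  fix x w i
  assume x: "\<forall>i. i \<notin> P \<longrightarrow> x i = (\<Sum>j\<in>UNIV. (\<Lambda> i j + of_bool (i = q \<and> j = p)) * x j)"
    and w: "\<forall>j. w j = (\<Sum>i\<in>UNIV. of_bool ((i,j) \<in> C) * (\<Lambda> i j + of_bool (i = q \<and> j = p)) * w i) +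
              (\<Sum>i\<in>UNIV. S j i * x i)"
    and w0: "\<forall>y\<in>Y. w y = 0"
  define x' where "x' = x(p := 0)"
  define w' where "w' = w(p := w p - of_bool ((q,p) \<in> C) * w q)"
  have R: "(\<Sum>j\<in>UNIV. (\<Lambda> i j + of_bool (i = q \<and> j = p)) * x j)
      = (\<Sum>j\<in>UNIV. \<Lambda> i j * x' j) + of_bool (i = q) * x p" for i
  proof -
    have "(\<Lambda> i j + of_bool (i = q \<and> j = p)) * x j = \<Lambda> i j * x j + (if j = p then of_bool (i = q) * x p else 0)" for j
      by (auto simp: distrib_right)
    then show ?thesis by (simp add: sum.distrib x'_def sum_upd_isolated iso)
  qed
  have L: "(\<Sum>i\<in>UNIV. of_bool ((i,j) \<in> C) * (\<Lambda> i j + of_bool (i = q \<and> j = p)) * w i)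
      = (\<Sum>i\<in>UNIV. of_bool ((i,j) \<in> C) * \<Lambda> i j * w' i) + of_bool (j = p) * of_bool ((q,p) \<in> C) * w q" for j
  proof -
    have "of_bool ((i,j) \<in> C) * (\<Lambda> i j + of_bool (i = q \<and> j = p)) * w i =
       of_bool ((i,j) \<in> C) * \<Lambda> i j * w i + (if i = q then of_bool (j = p) * of_bool ((q,p) \<in> C) * w q else 0)" for i
      by (auto simp: distrib_right)
    then show ?thesis
      by (simp add: sum.distrib w'_def sum_upd_isolated[of "\<lambda>i. of_bool ((i,j) \<in> C) * \<Lambda> i j"] iso)
  qed
  have x'eq: "x' i = (\<Sum>j\<in>UNIV. \<Lambda> i j * x' j)" if "i \<notin> insert q (P - {p})" for i
    using x[rule_format, of i] that unfolding R by (cases "i = p") (auto simp: x'_def iso)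
  have w'eq: "w' j = (\<Sum>i\<in>UNIV. of_bool ((i,j) \<in> C) * \<Lambda> i j * w' i) + (\<Sum>i\<in>UNIV. S j i * x' i)" for j
  proof -
    have "(\<Sum>i\<in>UNIV. S j i * x i) = (\<Sum>i\<in>UNIV. S j i * x' i)"
      by (simp add: x'_def sum_upd_isolated iso)
    moreover have "w' j = w j - of_bool (j = p) * of_bool ((q,p) \<in> C) * w q"
      by (simp add: w'_def)
    ultimately show ?thesis using w[rule_format, of j] unfolding L by linarith
  qed
  have w'0: "w' a = 0" if "a \<in> Y" for a
    using that w0 p by (auto simp: w'_def)
  have x'0: "x' i = 0" and w'0: "w' i = 0" for i
    using trivial_kernelD[OF sep x'eq w'eq w'0] by auto
  \<comment> \<open>With \<open>x' = 0\<close> the equation at \<open>q\<close> reads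
    \<open>0 = x p\<close>.\<close>
  have "x p = 0"
    using x[rule_format, OF p(4)] p(3) x'0[of q] unfolding R by (simp add: x'0) (metis x'0 fun_upd_other x'_def)
  then have x0: "x i = 0" for i using x'0[of i] by (auto simp: x'_def split: if_splits)
  have "w q = 0" using w'0[of q] p by (simp add: w'_def)
  then have "w i = 0"
    using w'0[of i] by (auto simp: w'_def split: if_splits)
  with x0 show "x i = 0 \<and> w i = 0" by simp
qed

definition supp_in :: "('n \<times> 'n) set \<Rightarrow> 'n set \<Rightarrow> ('n \<Rightarrow> 'n \<Rightarrow> real) \<Rightarrow> bool" where
  "supp_in E U f \<longleftrightarrow> (\<forall>i j. f i j \<noteq> 0 \<longrightarrow> (i,j) \<in> E \<and> i \<in> U \<and> j \<in> U)"

lemma supp_in_mono: "supp_in E U f \<Longrightarrow> U \<subseteq> U' \<Longrightarrow> supp_in E U' f"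
  unfolding supp_in_def by blast

lemma supp_in_isolated: "supp_in E U f \<Longrightarrow> p \<notin> U \<Longrightarrow> f p i = 0 \<and> f i p = 0"
  unfolding supp_in_def by blast

text \<open>The fourth clause says that \<open>I - \<Lambda>\<close> has trivial kernel. Confining
  both supports to \<open>U\<close> makes every node outside \<open>U\<close> isolated, as the two
  extension lemmas demand of \<open>p\<close>.\<close>

definition witness :: "('n::finite \<times> 'n) set \<Rightarrow> ('n \<times> 'n) set \<Rightarrow> ('n \<times> 'n) set \<Rightarrow> 'n set \<Rightarrow> 'n set \<Rightarrow> 'n set
    \<Rightarrow> ('n \<Rightarrow> 'n \<Rightarrow> real) \<Rightarrow> ('n \<Rightarrow> 'n \<Rightarrow> real) \<Rightarrow> bool" where
  "witness D B C U Y P \<Lambda> S \<longleftrightarrow>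
    supp_in D U \<Lambda> \<and> supp_in (Id \<union> B) U S \<and> (\<forall>i j. S i j = S j i) \<and>
    (\<forall>x. (\<forall>i. x i = (\<Sum>j\<in>UNIV. \<Lambda> i j * x j)) \<longrightarrow> (\<forall>i. x i = 0)) \<and>
    trivial_kernel \<Lambda> S C Y P"

lemma witnessD:
  assumes "witness D B C U Y P \<Lambda> S"
  shows "supp_in D U \<Lambda>" "supp_in (Id \<union> B) U S" "S i j = S j i"
    and "(\<And>i. x i = (\<Sum>j\<in>UNIV. \<Lambda> i j * x j)) \<Longrightarrow> x i = 0"
    and "trivial_kernel \<Lambda> S C Y P"
  using assms unfolding witness_def by blast+

lemma witness_mono: "witness D B C U Y P \<Lambda> S \<Longrightarrow> U \<subseteq> U' \<Longrightarrow> witness D B C U' Y P \<Lambda> S"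
  unfolding witness_def by (meson supp_in_mono)

text \<open>The mask \<open>C\<close> stays arbitrary in the induction because the bidirected step
  calls it with a smaller mask. \<open>D\<close> may have cycles, so a walk may visit its target
  early; such a loop is cut off first, so that the target is isolated once its last edge is
  removed.\<close>

lemma half_trek_witness_exists:
  fixes D B C :: "('n::finite \<times> 'n) set" and R :: "'n \<Rightarrow> 'n list"
  assumes "sym B"
    and "\<And>y. y \<in> Y \<Longrightarrow> R y \<noteq> [] \<and> successively (\<lambda>a b. (a,b) \<in> D) (R y) \<and> (hd (R y) = y \<or> (y, hd (R y)) \<in> B)"
    and "\<And>y y'. y \<in> Y \<Longrightarrow> y' \<in> Y \<Longrightarrow> y \<noteq> y' \<Longrightarrow> set (R y) \<inter> set (R y') = {}"
  shows "\<exists>\<Lambda> S. witness D B C (Y \<union> (\<Union>y\<in>Y. set (R y))) Y ((\<lambda>y. last (R y)) ` Y) \<Lambda> S"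
  using assms(2,3)
proof (induction "\<Sum>y\<in>Y. length (R y)" arbitrary: Y R C rule: less_induct)
  case (less Y R C)
  note path = less.prems(1) and disj = less.prems(2)
  let ?P = "\<lambda>Y R. (\<lambda>y. last (R y)) ` Y" and ?U = "\<lambda>Y R. Y \<union> (\<Union>y\<in>Y. set (R y))"
  have inj: "inj_on (\<lambda>y. last (R y)) Y"
  proof (rule inj_onI, rule ccontr)
    fix y y' assume *: "y \<in> Y" "y' \<in> Y" "last (R y) = last (R y')" "y \<noteq> y'"
    then have "last (R y) \<in> set (R y) \<inter> set (R y')"
      using path by (metis Int_iff last_in_set)
    then show False using disj * by auto
  qed
  show ?case
  proof (cases "?P Y R \<subseteq> Y")
    case True
    then have PY: "?P Y R = Y"
      using inj by (metis card_image card_subset_eq finite)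
    have "witness D B C (?U Y R) Y (?P Y R) (\<lambda>i j. 0) (\<lambda>i j. of_bool (i = j) * of_bool (j \<in> Y))"
      unfolding witness_def supp_in_def trivial_kernel_def PY
    proof (intro conjI allI impI; (auto simp: of_bool_def split: if_splits; fail)?)
      fix x w :: "'n \<Rightarrow> real" and i
      assume "\<forall>i. i \<notin> Y \<longrightarrow> x i = (\<Sum>j\<in>UNIV. 0 * x j)"
        and w: "\<forall>j. w j = (\<Sum>i\<in>UNIV. of_bool ((i, j) \<in> C) * 0 * w i) + (\<Sum>i\<in>UNIV. of_bool (j = i) * of_bool (i \<in> Y) * x i)"
        and w0: "\<forall>y\<in>Y. w y = 0"
      then have x: "x i = 0" if "i \<notin> Y" for i using that by auto
      have w: "w j = of_bool (j \<in> Y) * x j" for j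
      proof -
        have "of_bool (j = i) * of_bool (i \<in> Y) * x i = (if j = i then of_bool (j \<in> Y) * x j else 0)" for i by auto
        then show ?thesis using w by simp
      qed
      then have "x i = 0" for i using x w0 by (cases "i \<in> Y") auto
      then show "x i = 0" "w i = 0" using w by auto
    qed
    then show ?thesis by blast
  next
    case False
    then obtain y where y: "y \<in> Y" "last (R y) \<notin> Y" by auto
    define p where "p = last (R y)"
    have pP: "p \<in> ?P Y R" using y by (auto simp: p_def)
    have pY: "p \<notin> Y" using y by (simp add: p_def)
    have Ry: "R y = butlast (R y) @ [p]" using path[OF y(1)] by (simp add: p_def)
    have pother: "p \<notin> set (R y')" if "y' \<in> Y" "y' \<noteq> y" for y'
      using disj[OF y(1) that(1)] that(2) Ry by (metis disjoint_iff in_set_conv_decomp)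
    show ?thesis
    proof (cases "p \<in> set (butlast (R y))")
      case True
      then obtain as bs where ab: "butlast (R y) = as @ p # bs" by (meson split_list)
      define R' where "R' = R(y := as @ [p])"
      have Ry': "R y = (as @ [p]) @ (bs @ [p])" using Ry ab by simp
      have sub: "set (R' z) \<subseteq> set (R z)" for z using Ry' by (auto simp: R'_def)
      have "(\<Sum>z\<in>Y. length (R' z)) < (\<Sum>z\<in>Y. length (R z))"
        by (rule sum_strict_mono_ex1) (use y Ry' in \<open>auto simp: R'_def\<close>)
      moreover have "R' z \<noteq> [] \<and> successively (\<lambda>a b. (a,b) \<in> D) (R' z) \<and> (hd (R' z) = z \<or> (z, hd (R' z)) \<in> B)"
        if "z \<in> Y" for z
      proof (cases "z = y")
        case True
        have "successively (\<lambda>a b. (a,b) \<in> D) (as @ [p])" "hd (R y) = hd (as @ [p])"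
          using path[OF y(1)] unfolding Ry' successively_append_iff by (auto simp: hd_append)
        then show ?thesis using path[OF that] True by (simp add: R'_def)
      qed (use path that in \<open>auto simp: R'_def\<close>)
      moreover have "set (R' z) \<inter> set (R' z') = {}" if "z \<in> Y" "z' \<in> Y" "z \<noteq> z'" for z z'
        using disj[OF that] sub by blast
      ultimately obtain \<Lambda> S where wit: "witness D B C (?U Y R') Y (?P Y R') \<Lambda> S"
        using less.hyps[of R' Y C] by blast
      have U: "?U Y R' \<subseteq> ?U Y R" using sub by blast
      have L: "(\<lambda>z. last (R' z)) ` Y = ?P Y R"
        by (rule image_cong) (auto simp: R'_def p_def)
      have "witness D B C (?U Y R) Y (?P Y R) \<Lambda> S"
        using witness_mono[OF wit U] unfolding L .
      then show ?thesis by blast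
    next
      case pnot: False
      show ?thesis
      proof (cases "butlast (R y) = []")
        case True
        then have Ryp: "R y = [p]" using Ry by simp
        \<comment> \<open>\<open>p\<close> is no source, so it differs from \<open>y\<close> and the
          one-node half-trek is a bidirected edge.\<close>
        have yp: "y \<noteq> p" "(y,p) \<in> B" "(p,y) \<in> B" using path[OF y(1)] Ryp y(1) pY assms(1) by (auto dest: symD)
        have "(\<Sum>z\<in>Y - {y}. length (R z)) < (\<Sum>z\<in>Y. length (R z))"
          using y(1) Ryp by (simp add: sum.remove[of Y y])
        then obtain \<Lambda> S where wit: "witness D B (C - {y} \<times> UNIV) (?U (Y - {y}) R) (Y - {y}) (?P (Y - {y}) R) \<Lambda> S"
          using less.hyps[of R "Y - {y}" "C - {y} \<times> UNIV"] path disj by blast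
        have P: "(\<lambda>z. last (R z)) ` (Y - {y}) = ?P Y R - {p}"
          using inj y(1) by (auto simp: p_def inj_on_def)
        have U: "p \<notin> ?U (Y - {y}) R" using pother pY by auto
        have iso: "\<And>i. \<Lambda> p i = 0" "\<And>i. \<Lambda> i p = 0" "\<And>i. S p i = 0" "\<And>i. S i p = 0"
          using wit supp_in_isolated[OF _ U] unfolding witness_def by blast+
        have sep: "trivial_kernel \<Lambda> (\<lambda>i j. S i j + of_bool (i = y \<and> j = p \<or> i = p \<and> j = y)) C Y (?P Y R)"
          by (rule trivial_kernel_add_bidirected[where p = p and \<Lambda> = \<Lambda> and S = S, OF _ iso y(1) pP pY]) (use wit[unfolded witness_def P] in blast)
        have pU: "p \<in> (\<Union>z\<in>Y. set (R z))" using y(1) Ryp by force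
        have "witness D B C (?U Y R) Y (?P Y R) \<Lambda> (\<lambda>i j. S i j + of_bool (i = y \<and> j = p \<or> i = p \<and> j = y))"
          unfolding witness_def
        proof (intro conjI)
          have UU: "?U (Y - {y}) R \<subseteq> ?U Y R" by blast
          show "supp_in D (?U Y R) \<Lambda>"
            using wit supp_in_mono[OF _ UU] unfolding witness_def by blast
          have "supp_in (Id \<union> B) (?U Y R) S"
            using wit supp_in_mono[OF _ UU] unfolding witness_def by blast
          moreover have "S i j \<noteq> 0 \<or> i = y \<and> j = p \<or> i = p \<and> j = y"
            if "S i j + of_bool (i = y \<and> j = p \<or> i = p \<and> j = y) \<noteq> 0" for i j
            using that by (auto simp: of_bool_def split: if_splits)
          ultimately show "supp_in (Id \<union> B) (?U Y R) (\<lambda>i j. S i j + of_bool (i = y \<and> j = p \<or> i = p \<and> j = y))"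
            using yp pU y(1) unfolding supp_in_def by blast
          show "\<forall>i j. S i j + of_bool (i = y \<and> j = p \<or> i = p \<and> j = y) = S j i + of_bool (j = y \<and> i = p \<or> j = p \<and> i = y)"
          proof (intro allI)
            fix i j
            have "S i j = S j i" using wit unfolding witness_def by blast
            then show "S i j + of_bool (i = y \<and> j = p \<or> i = p \<and> j = y) = S j i + of_bool (j = y \<and> i = p \<or> j = p \<and> i = y)"
              by auto
          qed
          show "\<forall>x. (\<forall>i. x i = (\<Sum>j\<in>UNIV. \<Lambda> i j * x j)) \<longrightarrow> (\<forall>i. x i = 0)"
            using wit unfolding witness_def by blast
        qed (rule sep)
        then show ?thesis by blast
      next
        case False
        then obtain r q where rq: "butlast (R y) = r @ [q]" by (metis append_butlast_last_id)
        then have Ry': "R y = r @ [q] @ [p]" using Ry by simp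
        have pq: "p \<notin> set (r @ [q])" using pnot rq by simp
        define R' where "R' = R(y := r @ [q])"
        have sub: "set (R' z) \<subseteq> set (R z)" for z using Ry' by (auto simp: R'_def)
        have "(\<Sum>z\<in>Y. length (R' z)) < (\<Sum>z\<in>Y. length (R z))"
          by (rule sum_strict_mono_ex1) (use y Ry' in \<open>auto simp: R'_def\<close>)
        moreover have D: "(q,p) \<in> D \<and> successively (\<lambda>a b. (a,b) \<in> D) (r @ [q])"
          using path[OF y(1)] unfolding Ry' by (auto simp: successively_append_iff)
        moreover have "R' z \<noteq> [] \<and> successively (\<lambda>a b. (a,b) \<in> D) (R' z) \<and> (hd (R' z) = z \<or> (z, hd (R' z)) \<in> B)"
          if "z \<in> Y" for z
        proof (cases "z = y")
          case True
          have "hd (R y) = hd (r @ [q])" unfolding Ry' by (auto simp: hd_append)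
          then show ?thesis using path[OF that] True D by (simp add: R'_def)
        qed (use path that in \<open>auto simp: R'_def\<close>)
        moreover have "set (R' z) \<inter> set (R' z') = {}" if "z \<in> Y" "z' \<in> Y" "z \<noteq> z'" for z z'
          using disj[OF that] sub by blast
        ultimately obtain \<Lambda> S where wit: "witness D B C (?U Y R') Y (?P Y R') \<Lambda> S"
          using less.hyps[of R' Y C] by blast
        have P: "(\<lambda>z. last (R' z)) ` Y = insert q (?P Y R - {p})"
        proof -
          have "(\<lambda>z. last (R' z)) ` Y = insert (last (R' y)) ((\<lambda>z. last (R' z)) ` (Y - {y}))"
            using y(1) by blast
          also have "(\<lambda>z. last (R' z)) ` (Y - {y}) = (\<lambda>z. last (R z)) ` (Y - {y})"
            by (rule image_cong) (auto simp: R'_def)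
          also have "\<dots> = ?P Y R - {p}" using inj y(1) by (auto simp: p_def inj_on_def)
          finally show ?thesis by (simp add: R'_def)
        qed
        \<comment> \<open>Disjoint right sides keep \<open>q\<close> off every other half-trek, so
          it becomes a target only through the shortening.\<close>
        have qP: "q \<notin> ?P Y R"
        proof
          assume "q \<in> ?P Y R"
          then obtain z where z: "z \<in> Y" "q = last (R z)" by auto
          have "q \<noteq> p" using pq by auto
          then have "z \<noteq> y" using z by (auto simp: p_def)
          moreover have "q \<in> set (R z)" using z path by simp
          moreover have "q \<in> set (R y)" using Ry' by simp
          ultimately show False using disj z(1) y(1) by blast
        qed
        have U: "p \<notin> ?U Y R'" using pother pY pq by (auto simp: R'_def)
        have iso: "\<And>i. \<Lambda> p i = 0" "\<And>i. \<Lambda> i p = 0" "\<And>i. S p i = 0" "\<And>i. S i p = 0"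
          using wit supp_in_isolated[OF _ U] unfolding witness_def by blast+
        have sep: "trivial_kernel (\<lambda>i j. \<Lambda> i j + of_bool (i = q \<and> j = p)) S C Y (?P Y R)"
          by (rule trivial_kernel_add_directed[where p = p and \<Lambda> = \<Lambda> and S = S, OF _ iso pP pY _ qP]) (use wit[unfolded witness_def P] pq in \<open>blast | force\<close>)+
        have pU: "p \<in> (\<Union>z\<in>Y. set (R z))" "q \<in> (\<Union>z\<in>Y. set (R z))" using y(1) Ry' by force+
        have UU: "?U Y R' \<subseteq> ?U Y R" using sub by blast
        have "witness D B C (?U Y R) Y (?P Y R) (\<lambda>i j. \<Lambda> i j + of_bool (i = q \<and> j = p)) S"
          unfolding witness_def
        proof (intro conjI)
          have "supp_in D (?U Y R) \<Lambda>"
            using wit supp_in_mono[OF _ UU] unfolding witness_def by blast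
          moreover have "\<Lambda> i j \<noteq> 0 \<or> i = q \<and> j = p"
            if "\<Lambda> i j + of_bool (i = q \<and> j = p) \<noteq> 0" for i j
            using that by (auto simp: of_bool_def split: if_splits)
          ultimately show "supp_in D (?U Y R) (\<lambda>i j. \<Lambda> i j + of_bool (i = q \<and> j = p))"
            using D pU unfolding supp_in_def by blast
          show "supp_in (Id \<union> B) (?U Y R) S"
            using wit supp_in_mono[OF _ UU] unfolding witness_def by blast
          show "\<forall>i j. S i j = S j i"
            using wit unfolding witness_def by blast
          show "\<forall>x. (\<forall>i. x i = (\<Sum>j\<in>UNIV. (\<Lambda> i j + of_bool (i = q \<and> j = p)) * x j)) \<longrightarrow> (\<forall>i. x i = 0)"
          proof (intro allI impI)
            fix x :: "'n \<Rightarrow> real" and i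
            assume x: "\<forall>i. x i = (\<Sum>j\<in>UNIV. (\<Lambda> i j + of_bool (i = q \<and> j = p)) * x j)"
            \<comment> \<open>Row \<open>p\<close> remains zero because \<open>q \<noteq> p\<close>;
              so \<open>x p = 0\<close>, and the entry at \<open>(q, p)\<close> has no effect on the
              kernel.\<close>
            have "x p = 0" using x[rule_format, of p] pq iso(1) by auto
            then have "\<forall>i. x i = (\<Sum>j\<in>UNIV. \<Lambda> i j * x j)"
            proof (intro allI)
              fix i
              assume "x p = 0"
              then have "(\<Sum>j\<in>UNIV. (\<Lambda> i j + of_bool (i = q \<and> j = p)) * x j) = (\<Sum>j\<in>UNIV. \<Lambda> i j * x j)"
                by (intro sum.cong) auto
              then show "x i = (\<Sum>j\<in>UNIV. \<Lambda> i j * x j)" using x by metis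
            qed
            then show "x i = 0" using wit unfolding witness_def by blast
          qed
        qed (rule sep)
        then show ?thesis by blast
      qed
    qed
  qed
qed

subsection \<open>Generic properties and generically rational functions\<close>

lemma poly_fun_sum:
  assumes "\<And>i. i \<in> I \<Longrightarrow> poly_fun (f i)"
  shows "poly_fun (\<lambda>x. \<Sum>i\<in>I. f i x)"
  using assms by (induction I rule: infinite_finite_induct) (auto intro: poly_fun.intros)

lemma poly_fun_prod:
  assumes "\<And>i. i \<in> I \<Longrightarrow> poly_fun (f i)"
  shows "poly_fun (\<lambda>x. \<Prod>i\<in>I. f i x)"
  using assms by (induction I rule: infinite_finite_induct) (auto intro: poly_fun.intros)

lemma poly_fun_uminus:
  assumes "poly_fun f"
  shows "poly_fun (\<lambda>x. - f x)"
  using pf_mult[OF pf_const[of "-1"] assms] by simp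

lemma poly_fun_diff:
  assumes "poly_fun f" "poly_fun g"
  shows "poly_fun (\<lambda>x. f x - g x)"
  using pf_add[OF assms(1) poly_fun_uminus[OF assms(2)]] by simp

lemma poly_fun_det:
  fixes A :: "('v \<Rightarrow> real) \<Rightarrow> real^'n::finite^'n"
  assumes "\<And>i j. poly_fun (\<lambda>x. A x $ i $ j)"
  shows "poly_fun (\<lambda>x. det (A x))"
  unfolding det_def by (intro poly_fun_sum pf_mult pf_const poly_fun_prod assms)

text \<open>Restriction to a line turns nonvanishing in many variables into the finiteness of the
  roots of a univariate polynomial.\<close>

lemma poly_fun_on_line:
  assumes "poly_fun f"
  shows "\<exists>q. \<forall>t. f (\<lambda>i. a i + t * (b i - a i)) = poly q t"
  using assms
proof induction
  case (pf_const c)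
  then show ?case by (intro exI[of _ "[:c:]"]) simp
next
  case (pf_var i)
  then show ?case by (intro exI[of _ "[:a i, b i - a i:]"]) simp
next
  case (pf_add f g)
  then show ?case by (metis poly_add)
next
  case (pf_mult f g)
  then show ?case by (metis poly_mult)
qed

text \<open>\<open>Theta D B\<close> without invertibility and positive definiteness. Being a linear
  space it contains whole lines, and it admits half-trek witnesses whose \<open>\<Omega>\<close> is
  not positive definite.\<close>

definition ambient :: "('n::finite \<times> 'n) set \<Rightarrow> ('n \<times> 'n) set \<Rightarrow> ((real^'n^'n) \<times> (real^'n^'n)) set" where
  "ambient D B = {(\<Lambda>, \<Omega>). supported_on D \<Lambda> \<and> transpose \<Omega> = \<Omega> \<and>
     (\<forall>v w. v \<noteq> w \<and> (v,w) \<notin> B \<longrightarrow> \<Omega> $ v $ w = 0)}"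

lemma in_Theta_if_ambient:
  assumes "p \<in> ambient D B" "invertible (mat 1 - fst p)"
    and "\<And>x. x \<noteq> 0 \<Longrightarrow> x \<bullet> (snd p *v x) > 0"
  shows "p \<in> Theta D B"
  using assms by (cases p) (auto simp: Theta_def ambient_def PD_B_def)

lemma ambient_line:
  assumes "p \<in> ambient D B" "q \<in> ambient D B"
  shows "p + t *\<^sub>R (q - p) \<in> ambient D B"
  using assms unfolding ambient_def supported_on_def by (auto simp: vec_eq_iff transpose_def)

lemma param_coords_line:
  "param_coords (p + t *\<^sub>R (q - p)) = (\<lambda>i. param_coords p i + t * (param_coords q i - param_coords p i))"
  by (rule ext) (auto simp: param_coords_def split: sum.splits)

lemma poly_fun_zeros_on_line:
  assumes "poly_fun F" "F (param_coords (p + s *\<^sub>R (q - p))) \<noteq> 0"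
  shows "finite {t. F (param_coords (p + t *\<^sub>R (q - p))) = 0}"
proof -
  obtain f where f: "\<And>t. F (\<lambda>i. param_coords p i + t * (param_coords q i - param_coords p i)) = poly f t"
    using poly_fun_on_line[OF assms(1)] by metis
  have "poly f s \<noteq> 0" using assms(2) unfolding param_coords_line f .
  then have "f \<noteq> 0" by auto
  then show ?thesis unfolding param_coords_line f by (rule poly_roots_finite)
qed

text \<open>A linear space is irreducible: on the line through \<open>p\<close> and \<open>q\<close>
  each factor has only finitely many zeros, so some point of the line avoids them all.\<close>

lemma poly_fun_ambient_mult:
  assumes "poly_fun F" "p \<in> ambient D B" "F (param_coords p) \<noteq> 0"
    and "poly_fun G" "q \<in> ambient D B" "G (param_coords q) \<noteq> 0"
  shows "\<exists>r\<in>ambient D B. F (param_coords r) * G (param_coords r) \<noteq> 0"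
proof -
  let ?Z = "\<lambda>H. {t. H (param_coords (p + t *\<^sub>R (q - p))) = 0}"
  have "finite (?Z F)"
    by (rule poly_fun_zeros_on_line[where s = 0]) (use assms in simp_all)
  moreover have "finite (?Z G)"
    by (rule poly_fun_zeros_on_line[where s = 1]) (use assms in simp_all)
  ultimately have "finite (?Z F \<union> ?Z G)" by simp
  then obtain t where "t \<notin> ?Z F \<union> ?Z G"
    using ex_new_if_finite[OF infinite_UNIV_char_0] by metis
  then show ?thesis
    using ambient_line[OF assms(2,5)] by (intro bexI[of _ "p + t *\<^sub>R (q - p)"]) auto
qed

definition det_coords :: "(('n::finite \<times> 'n) + ('n \<times> 'n) \<Rightarrow> real) \<Rightarrow> real" where
  "det_coords x = det (\<chi> i j. of_bool (i = j) - x (Inl (i,j)) :: real^'n^'n)"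

lemma det_coords: "det_coords (param_coords p) = det (mat 1 - fst p)"
  unfolding det_coords_def by (rule arg_cong[where f = det]) (simp add: vec_eq_iff param_coords_def mat_def)

lemma poly_fun_det_coords: "poly_fun det_coords"
  unfolding det_coords_def[abs_def] by (rule poly_fun_det) (simp add: poly_fun_diff pf_const pf_var del: of_bool_eq_0_iff)

text \<open>By Cauchy-Schwarz and the operator norm \<open>?K\<close> of \<open>E\<close>, the
  perturbation changes the quadratic form by at most \<open>t * ?K\<close> times the squared norm of
  \<open>x\<close>.\<close>

lemma pos_definite_near_identity:
  fixes E :: "real^'n::finite^'n"
  shows "\<exists>\<delta>>0. \<forall>t. 0 < t \<and> t < \<delta> \<longrightarrow> (\<forall>x. x \<noteq> 0 \<longrightarrow> x \<bullet> ((mat 1 + t *\<^sub>R E) *v x) > 0)"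
proof -
  let ?K = "onorm ((*v) E)"
  have K: "0 \<le> ?K" by (rule onorm_pos_le) (rule matrix_vector_mul_bounded_linear)
  show ?thesis
  \<comment> \<open>The summand 1 keeps the radius positive when \<open>?K = 0\<close> and still
    gives \<open>t * ?K < 1\<close>.\<close>
  proof (intro exI[of _ "1 / (?K + 1)"] conjI allI impI)
    show "0 < 1 / (?K + 1)" using K by simp
    fix t :: real and x :: "real^'n"
    assume t: "0 < t \<and> t < 1 / (?K + 1)" and x: "x \<noteq> 0"
    have tK: "t * ?K < 1"
    proof -
      have "t * (?K + 1) < 1" using t K by (simp add: field_simps)
      then show ?thesis using t by (simp add: distrib_left)
    qed
    have "\<bar>x \<bullet> (E *v x)\<bar> \<le> norm x * norm (E *v x)" by (rule Cauchy_Schwarz_ineq2)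
    also have "\<dots> \<le> norm x * (?K * norm x)"
      by (intro mult_left_mono onorm) auto
    finally have "\<bar>x \<bullet> (E *v x)\<bar> \<le> ?K * (norm x)\<^sup>2" by (simp add: power2_eq_square mult_ac)
    then have "t * \<bar>x \<bullet> (E *v x)\<bar> \<le> t * ?K * (norm x)\<^sup>2" using t by (simp add: mult_left_mono mult.assoc)
    also have "\<dots> < 1 * (norm x)\<^sup>2" using tK x by (intro mult_strict_right_mono) auto
    finally have *: "t * \<bar>x \<bullet> (E *v x)\<bar> < (norm x)\<^sup>2" by simp
    have "x \<bullet> ((mat 1 + t *\<^sub>R E) *v x) = (norm x)\<^sup>2 + t * (x \<bullet> (E *v x))"
      by (simp add: matrix_vector_mult_add_rdistrib inner_add_right scaleR_matrix_vector_assoc[symmetric] power2_norm_eq_inner)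
    moreover have "\<bar>t * (x \<bullet> (E *v x))\<bar> = t * \<bar>x \<bullet> (E *v x)\<bar>" using t by (simp add: abs_mult)
    ultimately show "x \<bullet> ((mat 1 + t *\<^sub>R E) *v x) > 0" using * by linarith
  qed
qed

lemma identity_in_ambient: "(0, mat 1) \<in> ambient D B"
  by (auto simp: ambient_def supported_on_def transpose_def vec_eq_iff mat_def)

text \<open>Positive definiteness and invertibility cost nothing for genericity: on the line from
  \<open>(0, I)\<close> to a point of the ambient linear space, the points near \<open>(0, I)\<close> lie in the parameter
  space, and a polynomial that is nonzero at the far end has only finitely many zeros.\<close>

lemma poly_fun_nonzero_Theta:
  assumes "poly_fun F" "q \<in> ambient D B" "F (param_coords q) \<noteq> 0"
  shows "\<exists>p\<in>Theta D B. F (param_coords p) \<noteq> 0"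
proof -
  let ?o = "(0, mat 1) :: (real^'n^'n) \<times> (real^'n^'n)"
  \<comment> \<open>The determinant is nonzero at \<open>(0, I)\<close>, so it can be carried along
    as a second factor; a nonzero product then yields invertibility as well.\<close>
  have "det_coords (param_coords ?o) \<noteq> 0" by (simp add: det_coords)
  then obtain r where r: "r \<in> ambient D B" "F (param_coords r) * det_coords (param_coords r) \<noteq> 0"
    using poly_fun_ambient_mult[OF assms poly_fun_det_coords identity_in_ambient] by blast
  obtain \<delta> where \<delta>: "\<delta> > 0" "\<And>t x. 0 < t \<Longrightarrow> t < \<delta> \<Longrightarrow> x \<noteq> 0 \<Longrightarrow> x \<bullet> ((mat 1 + t *\<^sub>R (snd r - mat 1)) *v x) > 0"
    using pos_definite_near_identity[of "snd r - mat 1"] by blast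
  have "poly_fun (\<lambda>x. F x * det_coords x)"
    by (intro pf_mult assms poly_fun_det_coords)
  from poly_fun_zeros_on_line[OF this, of ?o 1 r] r
  have "finite {t. F (param_coords (?o + t *\<^sub>R (r - ?o))) * det_coords (param_coords (?o + t *\<^sub>R (r - ?o))) = 0}"
    by simp
  moreover have "infinite {0<..<\<delta>}" using \<delta>(1) by simp
  ultimately obtain t where t: "0 < t" "t < \<delta>"
    and nz: "F (param_coords (?o + t *\<^sub>R (r - ?o))) \<noteq> 0" "det_coords (param_coords (?o + t *\<^sub>R (r - ?o))) \<noteq> 0"
    by (smt (verit) finite_subset greaterThanLessThan_iff mem_Collect_eq mult_eq_0_iff subsetI)
  have "?o + t *\<^sub>R (r - ?o) \<in> ambient D B" by (rule ambient_line[OF identity_in_ambient r(1)])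
  moreover have "invertible (mat 1 - fst (?o + t *\<^sub>R (r - ?o)))"
    using nz(2) unfolding det_coords invertible_det_nz .
  moreover have "x \<bullet> (snd (?o + t *\<^sub>R (r - ?o)) *v x) > 0" if "x \<noteq> 0" for x
    using \<delta>(2)[OF t that] by simp
  ultimately have "?o + t *\<^sub>R (r - ?o) \<in> Theta D B"
    by (intro in_Theta_if_ambient)
  with nz(1) show ?thesis by (rule bexI)
qed

text \<open>The certificate \<open>F\<close> has to be nonzero only somewhere in the ambient space,
  so a witness need not lie in \<open>Theta D B\<close>; \<open>poly_fun_nonzero_Theta\<close> then
  provides a point of \<open>Theta D B\<close> itself.\<close>

definition generically :: "('n::finite \<times> 'n) set \<Rightarrow> ('n \<times> 'n) set \<Rightarrow> ((real^'n^'n) \<times> (real^'n^'n) \<Rightarrow> bool) \<Rightarrow> bool" where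
  "generically D B P \<longleftrightarrow> (\<exists>F. poly_fun F \<and> (\<exists>p\<in>ambient D B. F (param_coords p) \<noteq> 0) \<and>
     (\<forall>p\<in>Theta D B. F (param_coords p) \<noteq> 0 \<longrightarrow> P p))"

lemma generically_mono:
  assumes "generically D B P" "\<And>p. p \<in> Theta D B \<Longrightarrow> P p \<Longrightarrow> Q p"
  shows "generically D B Q"
  using assms unfolding generically_def by meson

lemma generically_Theta: "generically D B (\<lambda>p. p \<in> Theta D B)"
  unfolding generically_def
  by (intro exI[of _ "\<lambda>_. 1"]) (use identity_in_ambient in \<open>auto intro: pf_const\<close>)

lemma generically_conj:
  assumes "generically D B P" "generically D B Q"
  shows "generically D B (\<lambda>p. P p \<and> Q p)"
proof -
  obtain F p where F: "poly_fun F" "p \<in> ambient D B" "F (param_coords p) \<noteq> 0"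
      "\<forall>p\<in>Theta D B. F (param_coords p) \<noteq> 0 \<longrightarrow> P p"
    using assms(1) unfolding generically_def by blast
  obtain G q where G: "poly_fun G" "q \<in> ambient D B" "G (param_coords q) \<noteq> 0"
      "\<forall>p\<in>Theta D B. G (param_coords p) \<noteq> 0 \<longrightarrow> Q p"
    using assms(2) unfolding generically_def by blast
  show ?thesis
    unfolding generically_def
    by (intro exI[of _ "\<lambda>x. F x * G x"] conjI pf_mult F G poly_fun_ambient_mult[OF F(1-3) G(1-3)])
       (use F(4) G(4) in auto)
qed

lemma generically_all:
  fixes P :: "'k::finite \<Rightarrow> _"
  assumes "\<And>k. generically D B (P k)"
  shows "generically D B (\<lambda>p. \<forall>k. P k p)"
proof -
  have "generically D B (\<lambda>p. \<forall>k\<in>K. P k p)" if "finite K" for K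
    using that
  proof induction
    case empty
    then show ?case by (auto intro: generically_mono[OF generically_Theta])
  next
    case (insert k K)
    show ?case by (rule generically_mono[OF generically_conj[OF assms[of k] insert.IH]]) auto
  qed
  from this[of UNIV] show ?thesis by simp
qed

section \<open>Generically rational functions of Sigma\<close>

text \<open>The two polynomials do not depend on the point; only their agreement with
  \<open>g\<close> is generic, so the exceptional set may grow with each step of the recovery.
  Nonvanishing of \<open>den\<close> is demanded explicitly because division by zero returns
  0.\<close>

definition gen_rat :: "('n::finite \<times> 'n) set \<Rightarrow> ('n \<times> 'n) set \<Rightarrow> ((real^'n^'n) \<times> (real^'n^'n) \<Rightarrow> real) \<Rightarrow> bool" where
  "gen_rat D B g \<longleftrightarrow> (\<exists>num den. poly_fun num \<and> poly_fun den \<and>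
     generically D B (\<lambda>p. den (mat_coords (phiG p)) \<noteq> 0 \<and>
       num (mat_coords (phiG p)) / den (mat_coords (phiG p)) = g p))"

lemma gen_ratI:
  assumes "poly_fun num" "poly_fun den"
    and "generically D B (\<lambda>p. den (mat_coords (phiG p)) \<noteq> 0 \<and> num (mat_coords (phiG p)) / den (mat_coords (phiG p)) = g p)"
  shows "gen_rat D B g"
  using assms unfolding gen_rat_def by blast

lemma gen_ratE:
  assumes "gen_rat D B g"
  obtains num den where "poly_fun num" "poly_fun den"
    "generically D B (\<lambda>p. den (mat_coords (phiG p)) \<noteq> 0 \<and> num (mat_coords (phiG p)) / den (mat_coords (phiG p)) = g p)"
  using assms unfolding gen_rat_def by blast

lemma gen_rat_poly:
  assumes "poly_fun f"
  shows "gen_rat D B (\<lambda>p. f (mat_coords (phiG p)))"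
  by (rule gen_ratI[of f "\<lambda>_. 1", OF assms pf_const generically_mono[OF generically_Theta]]) auto

lemma gen_rat_const: "gen_rat D B (\<lambda>p. c)"
  using gen_rat_poly[OF pf_const] .

lemma gen_rat_Sigma: "gen_rat D B (\<lambda>p. phiG p $ i $ j)"
  using gen_rat_poly[OF pf_var[of "(i,j)"]] by (simp add: mat_coords_def)

lemma gen_rat_cong:
  assumes "gen_rat D B g" "generically D B (\<lambda>p. g p = h p)"
  shows "gen_rat D B h"
  using assms(1)
proof (rule gen_ratE)
  fix num den
  assume *: "poly_fun num" "poly_fun den"
    "generically D B (\<lambda>p. den (mat_coords (phiG p)) \<noteq> 0 \<and> num (mat_coords (phiG p)) / den (mat_coords (phiG p)) = g p)"
  show ?thesis
    by (rule gen_ratI[of num den, OF _ _ generically_mono[OF generically_conj[OF *(3) assms(2)]]]) (auto intro!: * )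
qed

lemma gen_rat_add:
  assumes "gen_rat D B g" "gen_rat D B h"
  shows "gen_rat D B (\<lambda>p. g p + h p)"
proof -
  obtain n d where 1: "poly_fun n" "poly_fun d"
    "generically D B (\<lambda>p. d (mat_coords (phiG p)) \<noteq> 0 \<and> n (mat_coords (phiG p)) / d (mat_coords (phiG p)) = g p)"
    using assms(1) by (rule gen_ratE)
  obtain n' d' where 2: "poly_fun n'" "poly_fun d'"
    "generically D B (\<lambda>p. d' (mat_coords (phiG p)) \<noteq> 0 \<and> n' (mat_coords (phiG p)) / d' (mat_coords (phiG p)) = h p)"
    using assms(2) by (rule gen_ratE)
  show ?thesis
    by (rule gen_ratI[of "\<lambda>x. n x * d' x + n' x * d x" "\<lambda>x. d x * d' x",
          OF _ _ generically_mono[OF generically_conj[OF 1(3) 2(3)]]])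
       (auto intro!: pf_add pf_mult 1 2 simp: add_divide_distrib)
qed

lemma gen_rat_mult:
  assumes "gen_rat D B g" "gen_rat D B h"
  shows "gen_rat D B (\<lambda>p. g p * h p)"
proof -
  obtain n d where 1: "poly_fun n" "poly_fun d"
    "generically D B (\<lambda>p. d (mat_coords (phiG p)) \<noteq> 0 \<and> n (mat_coords (phiG p)) / d (mat_coords (phiG p)) = g p)"
    using assms(1) by (rule gen_ratE)
  obtain n' d' where 2: "poly_fun n'" "poly_fun d'"
    "generically D B (\<lambda>p. d' (mat_coords (phiG p)) \<noteq> 0 \<and> n' (mat_coords (phiG p)) / d' (mat_coords (phiG p)) = h p)"
    using assms(2) by (rule gen_ratE)
  show ?thesis
    by (rule gen_ratI[of "\<lambda>x. n x * n' x" "\<lambda>x. d x * d' x",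
          OF _ _ generically_mono[OF generically_conj[OF 1(3) 2(3)]]])
       (auto intro!: pf_mult 1 2 simp flip: times_divide_times_eq)
qed

lemma gen_rat_divide:
  assumes "gen_rat D B g" "gen_rat D B h" "generically D B (\<lambda>p. h p \<noteq> 0)"
  shows "gen_rat D B (\<lambda>p. g p / h p)"
proof -
  obtain n d where 1: "poly_fun n" "poly_fun d"
    "generically D B (\<lambda>p. d (mat_coords (phiG p)) \<noteq> 0 \<and> n (mat_coords (phiG p)) / d (mat_coords (phiG p)) = g p)"
    using assms(1) by (rule gen_ratE)
  obtain n' d' where 2: "poly_fun n'" "poly_fun d'"
    "generically D B (\<lambda>p. d' (mat_coords (phiG p)) \<noteq> 0 \<and> n' (mat_coords (phiG p)) / d' (mat_coords (phiG p)) = h p)"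
    using assms(2) by (rule gen_ratE)
  show ?thesis
    \<comment> \<open>The new denominator contains \<open>n'\<close>, which is generically nonzero
      because \<open>n' / d'\<close> agrees with \<open>h\<close>.\<close>
    by (rule gen_ratI[of "\<lambda>x. n x * d' x" "\<lambda>x. d x * n' x",
          OF _ _ generically_mono[OF generically_conj[OF generically_conj[OF 1(3) 2(3)] assms(3)]]])
       (auto intro!: pf_mult 1 2 simp flip: divide_divide_times_eq)
qed

lemma gen_rat_diff:
  assumes "gen_rat D B g" "gen_rat D B h"
  shows "gen_rat D B (\<lambda>p. g p - h p)"
  using gen_rat_add[OF assms(1) gen_rat_mult[OF gen_rat_const[of _ _ "-1"] assms(2)]] by simp

lemma gen_rat_sum:
  assumes "\<And>i. i \<in> I \<Longrightarrow> gen_rat D B (f i)"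
  shows "gen_rat D B (\<lambda>p. \<Sum>i\<in>I. f i p)"
  using assms by (induction I rule: infinite_finite_induct) (auto intro: gen_rat_const gen_rat_add)

lemma gen_rat_prod:
  assumes "\<And>i. i \<in> I \<Longrightarrow> gen_rat D B (f i)"
  shows "gen_rat D B (\<lambda>p. \<Prod>i\<in>I. f i p)"
  using assms by (induction I rule: infinite_finite_induct) (auto intro: gen_rat_const gen_rat_mult)

lemma gen_rat_det:
  fixes A :: "_ \<Rightarrow> real^'m::finite^'m"
  assumes "\<And>i j. gen_rat D B (\<lambda>p. A p $ i $ j)"
  shows "gen_rat D B (\<lambda>p. det (A p))"
  unfolding det_def by (intro gen_rat_sum gen_rat_mult gen_rat_const gen_rat_prod assms)

text \<open>There are finitely many coordinates, so one polynomial \<open>F\<close> certifies all of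
  them at once; \<open>W\<close> is its zero set in \<open>Theta D B\<close>, proper because
  \<open>F\<close> does not vanish identically there.\<close>

lemma rationally_identifiable_if_gen_rat:
  assumes "\<And>k. gen_rat D B (\<lambda>p. param_coords p k)"
  shows "rationally_identifiable D B"
proof -
  have "\<forall>k. \<exists>n d. poly_fun n \<and> poly_fun d \<and> generically D B (\<lambda>p. d (mat_coords (phiG p)) \<noteq> 0 \<and>
      n (mat_coords (phiG p)) / d (mat_coords (phiG p)) = param_coords p k)"
    using assms unfolding gen_rat_def by blast
  from choice[OF this] obtain n where "\<forall>k. \<exists>d. poly_fun (n k) \<and> poly_fun d \<and>
      generically D B (\<lambda>p. d (mat_coords (phiG p)) \<noteq> 0 \<and>
      n k (mat_coords (phiG p)) / d (mat_coords (phiG p)) = param_coords p k)" ..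
  from choice[OF this] obtain d where nd: "\<forall>k. poly_fun (n k) \<and> poly_fun (d k) \<and>
      generically D B (\<lambda>p. d k (mat_coords (phiG p)) \<noteq> 0 \<and>
      n k (mat_coords (phiG p)) / d k (mat_coords (phiG p)) = param_coords p k)" ..
  then have "generically D B (\<lambda>p. \<forall>k. d k (mat_coords (phiG p)) \<noteq> 0 \<and>
      n k (mat_coords (phiG p)) / d k (mat_coords (phiG p)) = param_coords p k)"
    by (intro generically_all) simp
  then obtain F q where F: "poly_fun F" "q \<in> ambient D B" "F (param_coords q) \<noteq> 0"
    "\<And>p k. p \<in> Theta D B \<Longrightarrow> F (param_coords p) \<noteq> 0 \<Longrightarrow> d k (mat_coords (phiG p)) \<noteq> 0 \<and>
      n k (mat_coords (phiG p)) / d k (mat_coords (phiG p)) = param_coords p k"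
    unfolding generically_def by blast
  let ?W = "{p \<in> Theta D B. F (param_coords p) = 0}"
  have "algebraic_subset_of ?W (Theta D B)"
    unfolding algebraic_subset_of_def by (intro exI[of _ "{F}"]) (use F in auto)
  moreover have "?W \<noteq> Theta D B"
    using poly_fun_nonzero_Theta[OF F(1-3)] by blast
  ultimately show ?thesis
    unfolding rationally_identifiable_def
    by (intro exI[of _ ?W] exI[of _ n] exI[of _ d]) (use nd F(4) in auto)
qed

subsection \<open>The linear system of the half-trek criterion\<close>

text \<open>Trading node lists for reachability makes the closure of \<open>htr\<close> under
  directed paths a matter of transitivity.\<close>

lemma is_half_trek_iff:
  "(\<exists>R. is_half_trek D B v w R) \<longleftrightarrow> (\<exists>u. (u = v \<or> (v,u) \<in> B) \<and> (u,w) \<in> D\<^sup>*)"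
proof
  assume "\<exists>R. is_half_trek D B v w R"
  then obtain R where R: "R \<noteq> []" "successively (\<lambda>a b. (a,b) \<in> D) R" "last R = w" "hd R = v \<or> (v, hd R) \<in> B"
    unfolding is_half_trek_def by blast
  have "(hd R, last R) \<in> D\<^sup>*" using R(1,2)
  proof (induction R rule: induct_list012)
    case (3 x y zs)
    then show ?case by (auto intro: converse_rtrancl_into_rtrancl)
  qed auto
  with R show "\<exists>u. (u = v \<or> (v,u) \<in> B) \<and> (u,w) \<in> D\<^sup>*" by auto
next
  assume "\<exists>u. (u = v \<or> (v,u) \<in> B) \<and> (u,w) \<in> D\<^sup>*"
  then obtain u where u: "u = v \<or> (v,u) \<in> B" "(u,w) \<in> D\<^sup>*" by blast
  from u(2) have "\<exists>R. R \<noteq> [] \<and> successively (\<lambda>a b. (a,b) \<in> D) R \<and> last R = w \<and> hd R = u"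
  proof (induction rule: converse_rtrancl_induct)
    case base
    show ?case by (intro exI[of _ "[w]"]) simp
  next
    case (step y z)
    then obtain R where "R \<noteq> []" "successively (\<lambda>a b. (a,b) \<in> D) R" "last R = w" "hd R = z" by blast
    with step(1) show ?case by (intro exI[of _ "y # R"]) (auto simp: successively_Cons)
  qed
  with u(1) show "\<exists>R. is_half_trek D B v w R" unfolding is_half_trek_def by auto
qed

lemma htr_closed:
  assumes "y \<in> htr D B v" "(y,z) \<in> D\<^sup>*" "z \<notin> insert v (sib B v)"
  shows "z \<in> htr D B v"
  using assms unfolding htr_def is_half_trek_iff by (blast intro: rtrancl_trans)

lemma matrix_inv_inverse:
  assumes "invertible (A :: real^'n::finite^'n)"
  shows "A ** matrix_inv A = mat 1" "matrix_inv A ** A = mat 1"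
  using someI_ex[OF assms[unfolded invertible_def]] unfolding matrix_inv_def by auto

lemma invertible_iff_ker:
  "invertible (A :: real^'n::finite^'n) \<longleftrightarrow> (\<forall>x. A *v x = 0 \<longrightarrow> x = 0)"
  by (simp add: invertible_left_inverse matrix_left_invertible_ker)

lemma one_minus_mult_vec:
  fixes L :: "real^'n::finite^'n"
  shows "((mat 1 - L) *v x) $ i = x $ i - (\<Sum>j\<in>UNIV. L $ i $ j * x $ j)"
  by (simp add: matrix_vector_mult_diff_rdistrib) (simp add: matrix_vector_mult_def)

lemma mult_one_minus:
  fixes L :: "real^'n::finite^'n"
  shows "(A ** (mat 1 - L)) $ i $ v = A $ i $ v - (\<Sum>j\<in>UNIV. A $ i $ j * L $ j $ v)"
  by (simp add: matrix_matrix_mult_def right_diff_distrib sum_subtractf mat_def if_distrib[of "\<lambda>x. _ * x"] cong: if_cong)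

lemma transpose_one_minus_mult:
  fixes L :: "real^'n::finite^'n"
  shows "(transpose (mat 1 - L) ** A) $ i $ v = A $ i $ v - (\<Sum>j\<in>UNIV. L $ j $ i * A $ j $ v)"
  by (simp add: matrix_matrix_mult_def transpose_def left_diff_distrib sum_subtractf mat_def if_distrib[of "\<lambda>x. x * _"] cong: if_cong)

text \<open>Directed cycles are allowed, so the power series for the inverse need not converge.
  Instead \<open>L\<close> is cut down to the ancestors of \<open>y\<close>. No entry of
  \<open>L\<close> leads from a non-ancestor into this set, so vectors supported there do not see
  the cut, and solving \<open>(mat 1 - L') *v m = axis y 1\<close> yields column \<open>y\<close> of
  the inverse.\<close>

lemma matrix_inv_support:
  fixes L :: "real^'n::finite^'n"
  assumes "supported_on D L" "invertible (mat 1 - L)" "matrix_inv (mat 1 - L) $ z $ y \<noteq> 0"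
  shows "(z,y) \<in> D\<^sup>*"
proof (rule ccontr)
  assume zy: "(z,y) \<notin> D\<^sup>*"
  define An where "An = {u. (u,y) \<in> D\<^sup>*}"
  have L0: "L $ i $ j = 0" if "i \<notin> An" "j \<in> An" for i j
  proof (rule ccontr)
    assume "L $ i $ j \<noteq> 0"
    then have "(i,j) \<in> D" using assms(1) unfolding supported_on_def by blast
    with that show False unfolding An_def by (auto intro: converse_rtrancl_into_rtrancl)
  qed
  define L' :: "real^'n^'n" where "L' = (\<chi> i j. of_bool (i \<in> An \<and> j \<in> An) * L $ i $ j)"
  have supp: "(\<Sum>j\<in>UNIV. L' $ i $ j * x $ j) = (\<Sum>j\<in>UNIV. L $ i $ j * x $ j)"
    if "\<And>j. j \<notin> An \<Longrightarrow> x $ j = 0" for x and i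
    by (rule sum.cong) (use L0 that in \<open>auto simp: L'_def\<close>)
  have supp': "x $ i = 0" if "((mat 1 - L') *v x) $ i = 0" "i \<notin> An" for x and i
    using that unfolding one_minus_mult_vec L'_def by simp
  \<comment> \<open>A kernel vector of \<open>mat 1 - L'\<close> vanishes off \<open>An\<close>,
    hence is a kernel vector of \<open>mat 1 - L\<close>.\<close>
  have inv': "invertible (mat 1 - L')"
    unfolding invertible_iff_ker
  proof (intro allI impI)
    fix x assume x: "(mat 1 - L') *v x = 0"
    then have "x $ j = 0" if "j \<notin> An" for j using supp' that by simp
    note supp[OF this]
    then have "(mat 1 - L') *v x = (mat 1 - L) *v x" by (simp add: vec_eq_iff one_minus_mult_vec)
    with x assms(2) show "x = 0" unfolding invertible_iff_ker by simp
  qed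
  define m where "m = matrix_inv (mat 1 - L') *v axis y 1"
  have m: "(mat 1 - L') *v m = axis y 1"
    unfolding m_def matrix_vector_mul_assoc matrix_inv_inverse(1)[OF inv'] by simp
  have m0: "m $ j = 0" if "j \<notin> An" for j
    by (rule supp'[OF _ that]) (use that in \<open>auto simp: m axis_def An_def\<close>)
  have "(mat 1 - L) *v m = (mat 1 - L') *v m"
    using supp[OF m0] by (simp add: vec_eq_iff one_minus_mult_vec)
  then have "matrix_inv (mat 1 - L) *v ((mat 1 - L) *v m) = matrix_inv (mat 1 - L) *v axis y 1"
    by (simp add: m)
  then have "m = matrix_inv (mat 1 - L) *v axis y 1"
    unfolding matrix_vector_mul_assoc matrix_inv_inverse(2)[OF assms(2)] by simp
  then have "m $ z = matrix_inv (mat 1 - L) $ z $ y"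
    by (simp add: matrix_vector_mult_basis column_def)
  with m0[of z] zy assms(3) show False by (simp add: An_def)
qed

text \<open>A row of \<open>(I - \<Lambda>)\<^sup>T \<Sigma>\<close> or of \<open>\<Sigma>\<close>
  itself. It reads \<open>\<Lambda>\<close> only in column \<open>y\<close> and only for
  \<open>y \<in> htr D B v\<close>; for such \<open>y\<close> in \<open>Y v\<close> the order on the
  nodes makes that column available.\<close>

definition htc_entry :: "('n::finite \<times> 'n) set \<Rightarrow> ('n \<times> 'n) set \<Rightarrow> 'n
    \<Rightarrow> real^'n^'n \<Rightarrow> real^'n^'n \<Rightarrow> 'n \<Rightarrow> 'n \<Rightarrow> real" where
  "htc_entry D B v \<Lambda> \<Sigma> y j =
     (if y \<in> htr D B v then \<Sigma> $ y $ j - (\<Sum>k\<in>UNIV. \<Lambda> $ k $ y * \<Sigma> $ k $ j) else \<Sigma> $ y $ j)"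

lemma htc_entry_phiG:
  assumes "invertible (mat 1 - \<Lambda>)"
  shows "htc_entry D B v \<Lambda> (phiG (\<Lambda>, \<Omega>)) y j =
    (if y \<in> htr D B v then \<Omega> ** matrix_inv (mat 1 - \<Lambda>)
     else transpose (matrix_inv (mat 1 - \<Lambda>)) ** \<Omega> ** matrix_inv (mat 1 - \<Lambda>)) $ y $ j"
proof -
  let ?M = "matrix_inv (mat 1 - \<Lambda>)"
  have "transpose (mat 1 - \<Lambda>) ** (transpose ?M ** \<Omega> ** ?M) = transpose (?M ** (mat 1 - \<Lambda>)) ** \<Omega> ** ?M"
    by (simp add: matrix_mul_assoc matrix_transpose_mul)
  also have "\<dots> = \<Omega> ** ?M" by (simp add: matrix_inv_inverse(2)[OF assms] transpose_mat)
  finally have "(transpose (mat 1 - \<Lambda>) ** phiG (\<Lambda>, \<Omega>)) $ y $ j = (\<Omega> ** ?M) $ y $ j"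
    by (simp add: phiG_def)
  then show ?thesis
    unfolding transpose_one_minus_mult htc_entry_def by (simp add: phiG_def)
qed

text \<open>After multiplication by \<open>mat 1 - \<Lambda>\<close> the entry \<open>(y, v)\<close>
  is \<open>\<Omega> $ y $ v\<close> or the sum of \<open>?M $ z $ y * \<Omega> $ z $ v\<close> over
  \<open>z\<close>. A nonzero term of that sum needs a directed path from \<open>z\<close> to
  \<open>y\<close> and \<open>z = v\<close> or \<open>v \<leftrightarrow> z\<close>, that is, a
  half-trek from \<open>v\<close> to \<open>y\<close>, contrary to
  \<open>y \<notin> htr D B v\<close>.\<close>

lemma htc_equation:
  assumes "(\<Lambda>, \<Omega>) \<in> Theta D B" "sym B" "y \<notin> insert v (sib B v)"
  shows "(\<Sum>j\<in>UNIV. htc_entry D B v \<Lambda> (phiG (\<Lambda>, \<Omega>)) y j * \<Lambda> $ j $ v) = htc_entry D B v \<Lambda> (phiG (\<Lambda>, \<Omega>)) y v"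
proof -
  let ?M = "matrix_inv (mat 1 - \<Lambda>)"
  define A where "A = (if y \<in> htr D B v then \<Omega> ** ?M else transpose ?M ** \<Omega> ** ?M)"
  have supp: "supported_on D \<Lambda>" and inv: "invertible (mat 1 - \<Lambda>)"
    and \<Omega>: "\<And>v w. v \<noteq> w \<Longrightarrow> (v,w) \<notin> B \<Longrightarrow> \<Omega> $ v $ w = 0"
    using assms(1) by (auto simp: Theta_def PD_B_def)
  have MI: "X ** ?M ** (mat 1 - \<Lambda>) = X" for X :: "real^'a^'a"
    by (simp add: matrix_mul_assoc[symmetric] matrix_inv_inverse(2)[OF inv])
  have yv: "y \<noteq> v" "(y,v) \<notin> B" using assms(3) by (auto simp: sib_def)
  have "(A ** (mat 1 - \<Lambda>)) $ y $ v = 0"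
  proof (cases "y \<in> htr D B v")
    case True
    then show ?thesis unfolding A_def by (simp add: MI \<Omega> yv)
  next
    case False
    have "?M $ z $ y * \<Omega> $ z $ v = 0" for z
    proof (rule ccontr)
      assume "?M $ z $ y * \<Omega> $ z $ v \<noteq> 0"
      then have "(z,y) \<in> D\<^sup>*" "z = v \<or> (v,z) \<in> B"
        using matrix_inv_support[OF supp inv] \<Omega> assms(2) by (fastforce, metis mult_zero_right symD)
      then show False using False assms(3) unfolding htr_def is_half_trek_iff by blast
    qed
    then have "(transpose ?M ** \<Omega>) $ y $ v = 0"
      unfolding matrix_matrix_mult_def by (simp add: transpose_def sum.neutral del: mult_eq_0_iff)
    then show ?thesis using False unfolding A_def by (simp add: MI)
  qed
  then show ?thesis
    unfolding mult_one_minus htc_entry_phiG[OF inv] A_def by simp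
qed

text \<open>The equations for the nodes of \<open>Y v\<close> are indexed by the parents of \<open>v\<close> through a bijection
  \<open>\<tau>\<close>, and the remaining rows force \<open>\<Lambda> $ i $ v = 0\<close> at the non-parents \<open>i\<close>.\<close>

definition htc_matrix :: "('n::finite \<times> 'n) set \<Rightarrow> ('n \<times> 'n) set \<Rightarrow> 'n \<Rightarrow> ('n \<Rightarrow> 'n)
    \<Rightarrow> real^'n^'n \<Rightarrow> real^'n^'n \<Rightarrow> real^'n^'n" where
  "htc_matrix D B v \<tau> \<Lambda> \<Sigma> = (\<chi> i j. if i \<in> pa D v then htc_entry D B v \<Lambda> \<Sigma> (\<tau> i) j
     else of_bool (i = j))"

definition htc_vector :: "('n::finite \<times> 'n) set \<Rightarrow> ('n \<times> 'n) set \<Rightarrow> 'n \<Rightarrow> ('n \<Rightarrow> 'n)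
    \<Rightarrow> real^'n^'n \<Rightarrow> real^'n^'n \<Rightarrow> real^'n" where
  "htc_vector D B v \<tau> \<Lambda> \<Sigma> = (\<chi> i. if i \<in> pa D v then htc_entry D B v \<Lambda> \<Sigma> (\<tau> i) v else 0)"

lemma htc_system:
  assumes "(\<Lambda>, \<Omega>) \<in> Theta D B" "sym B" "\<And>i. i \<in> pa D v \<Longrightarrow> \<tau> i \<notin> insert v (sib B v)"
  shows "htc_matrix D B v \<tau> \<Lambda> (phiG (\<Lambda>, \<Omega>)) *v column v \<Lambda> = htc_vector D B v \<tau> \<Lambda> (phiG (\<Lambda>, \<Omega>))"
  unfolding vec_eq_iff
proof
  fix i
  show "(htc_matrix D B v \<tau> \<Lambda> (phiG (\<Lambda>, \<Omega>)) *v column v \<Lambda>) $ i = htc_vector D B v \<tau> \<Lambda> (phiG (\<Lambda>, \<Omega>)) $ i"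
  proof (cases "i \<in> pa D v")
    case True
    then show ?thesis using htc_equation[OF assms(1,2) assms(3)[OF True]]
      by (simp add: matrix_vector_mult_def htc_matrix_def htc_vector_def column_def)
  next
    case False
    then have "\<Lambda> $ i $ v = 0" using assms(1) by (auto simp: Theta_def supported_on_def pa_def)
    with False show ?thesis
      by (simp add: matrix_vector_mult_def htc_matrix_def htc_vector_def column_def of_bool_def if_distrib[of "\<lambda>x. x * _"] cong: if_cong)
  qed
qed

text \<open>No half-trek from \<open>v\<close> reaches \<open>Y - htr D B v\<close>, so the ancestors of that set contain no node of
  \<open>Y \<inter> htr D B v\<close>; masking by the edges into these ancestors therefore yields the right rows.\<close>

lemma det_htc_matrix_nonzero:
  fixes D B :: "('n::finite \<times> 'n) set" and \<Lambda> \<Omega> :: "real^'n^'n"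
  assumes supp: "supported_on D \<Lambda>" and inv: "invertible (mat 1 - \<Lambda>)"
    and \<tau>: "\<tau> ` pa D v = Y" and Y: "Y \<inter> insert v (sib B v) = {}"
    and sep: "trivial_kernel (\<lambda>i j. \<Lambda> $ i $ j) (\<lambda>i j. \<Omega> $ i $ j) (UNIV \<times> {q. \<exists>y\<in>Y - htr D B v. (q,y) \<in> D\<^sup>*}) Y (pa D v)"
  shows "det (htc_matrix D B v \<tau> \<Lambda> (phiG (\<Lambda>, \<Omega>))) \<noteq> 0"
  unfolding invertible_det_nz[symmetric] invertible_iff_ker
proof (intro allI impI)
  let ?M = "matrix_inv (mat 1 - \<Lambda>)"
  let ?Q = "{q. \<exists>y\<in>Y - htr D B v. (q,y) \<in> D\<^sup>*}"
  fix c :: "real^'n"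
  assume "htc_matrix D B v \<tau> \<Lambda> (phiG (\<Lambda>, \<Omega>)) *v c = 0"
  then have K: "(\<Sum>j\<in>UNIV. htc_matrix D B v \<tau> \<Lambda> (phiG (\<Lambda>, \<Omega>)) $ i $ j * c $ j) = 0" for i
    by (simp add: vec_eq_iff matrix_vector_mult_def)
  have c0: "c $ i = 0" if "i \<notin> pa D v" for i
    using K[of i] that by (simp add: htc_matrix_def of_bool_def if_distrib[of "\<lambda>x. x * _"] cong: if_cong)
  define x where "x = ?M *v c"
  define z where "z = \<Omega> *v x"
  define w where "w = transpose ?M *v z"
  \<comment> \<open>\<open>w'\<close> solves the masked recursion: \<open>?Q\<close> contains all
    ancestors of its nodes, so on it the recursion of \<open>w\<close> is untouched; off it the mask
    removes every edge and leaves \<open>z\<close>.\<close>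
  define w' where "w' = (\<lambda>j. if j \<in> ?Q then w $ j else z $ j)"
  have xc: "(mat 1 - \<Lambda>) *v x = c"
    unfolding x_def matrix_vector_mul_assoc matrix_inv_inverse(1)[OF inv] by simp
  have "transpose (mat 1 - \<Lambda>) *v w = transpose (?M ** (mat 1 - \<Lambda>)) *v z"
    unfolding w_def matrix_vector_mul_assoc matrix_transpose_mul ..
  then have "transpose (mat 1 - \<Lambda>) *v w = z" by (simp add: matrix_inv_inverse(2)[OF inv] transpose_mat)
  moreover have "transpose (mat 1 - \<Lambda>) = mat 1 - transpose \<Lambda>"
    by (simp add: vec_eq_iff transpose_def mat_def)
  ultimately have wz: "w $ j = (\<Sum>i\<in>UNIV. \<Lambda> $ i $ j * w $ i) + z $ j" for j
    using one_minus_mult_vec[of "transpose \<Lambda>" w j] by (simp add: transpose_def)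
  have row: "(if y \<in> htr D B v then z $ y else w $ y) = 0" if y: "y \<in> Y" for y
  proof -
    obtain i where i: "i \<in> pa D v" "y = \<tau> i" using \<tau> y by blast
    have "(\<Sum>j\<in>UNIV. htc_entry D B v \<Lambda> (phiG (\<Lambda>, \<Omega>)) y j * c $ j) = 0"
      using K[of i] i by (simp add: htc_matrix_def)
    moreover have "z = (\<Omega> ** ?M) *v c" "w = (transpose ?M ** \<Omega> ** ?M) *v c"
      by (simp_all add: z_def w_def x_def matrix_vector_mul_assoc matrix_mul_assoc)
    ultimately show ?thesis unfolding htc_entry_phiG[OF inv] by (auto simp: matrix_vector_mult_def)
  qed
  have x0: "x $ i = 0" for i
  proof (rule trivial_kernelD(1)[OF sep, where w = w' and x = "\<lambda>i. x $ i"])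
    fix i assume "i \<notin> pa D v"
    then show "x $ i = (\<Sum>j\<in>UNIV. \<Lambda> $ i $ j * x $ j)"
      using one_minus_mult_vec[of \<Lambda> x i] c0 by (simp add: xc)
  next
    fix j
    have z: "z $ j = (\<Sum>i\<in>UNIV. \<Omega> $ j $ i * x $ i)" by (simp add: z_def matrix_vector_mult_def)
    show "w' j = (\<Sum>i\<in>UNIV. of_bool ((i,j) \<in> UNIV \<times> ?Q) * \<Lambda> $ i $ j * w' i) + (\<Sum>i\<in>UNIV. \<Omega> $ j $ i * x $ i)"
    proof (cases "j \<in> ?Q")
      case True
      have eq: "\<Lambda> $ i $ j * w' i = \<Lambda> $ i $ j * w $ i" for i
      proof (cases "\<Lambda> $ i $ j = 0")
        case False
        then have "(i,j) \<in> D" using supp unfolding supported_on_def by blast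
        then have "i \<in> ?Q" using True by (auto intro: converse_rtrancl_into_rtrancl)
        then show ?thesis by (simp add: w'_def)
      qed simp
      have "(\<Sum>i\<in>UNIV. of_bool ((i,j) \<in> UNIV \<times> ?Q) * \<Lambda> $ i $ j * w' i) = (\<Sum>i\<in>UNIV. \<Lambda> $ i $ j * w $ i)"
        using True by (intro sum.cong) (simp_all add: eq del: mult_cancel_left)
      moreover have "w' j = w $ j" using True unfolding w'_def by (rule if_P)
      ultimately show ?thesis using wz[of j] z by simp
    next
      case False
      then have "w' j = z $ j" unfolding w'_def by (rule if_not_P)
      moreover have "(\<Sum>i\<in>UNIV. of_bool ((i,j) \<in> UNIV \<times> ?Q) * \<Lambda> $ i $ j * w' i) = 0"
        using False by (intro sum.neutral) simp
      ultimately show ?thesis using z by simp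
    qed
  next
    fix y assume y: "y \<in> Y"
    show "w' y = 0"
    proof (cases "y \<in> htr D B v")
      case True
      have "y \<notin> ?Q"
      proof
        assume "y \<in> ?Q"
        then obtain y' where y': "y' \<in> Y" "y' \<notin> htr D B v" "(y,y') \<in> D\<^sup>*" by auto
        then show False using htr_closed[OF True y'(3)] Y by blast
      qed
      then have "w' y = z $ y" unfolding w'_def by (rule if_not_P)
      then show ?thesis using row[OF y] True by simp
    next
      case False
      then have "y \<in> ?Q" using y by blast
      then have "w' y = w $ y" unfolding w'_def by (rule if_P)
      then show ?thesis using row[OF y] False by simp
    qed
  qed
  then have "x = 0" by (simp add: vec_eq_iff)
  then show "c = 0" using xc by simp
qed

section \<open>Cramer's rule and clearing of denominators\<close>

definition adjugate :: "real^'n::finite^'n \<Rightarrow> real^'n^'n" where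
  "adjugate A = (\<chi> k j. det (\<chi> a b. if b = k then axis j 1 $ a else A $ a $ b))"

text \<open>Cramer's rule for the unit vectors. Unlike \<open>matrix_inv\<close>, the adjugate is
  polynomial in the entries of \<open>A\<close>, as a certificate of genericity must be.\<close>

lemma adjugate_eq:
  fixes A :: "real^'n::finite^'n"
  assumes "invertible A"
  shows "adjugate A $ k $ j = det A * matrix_inv A $ k $ j"
proof -
  have det: "det A \<noteq> 0" using assms by (simp add: invertible_det_nz)
  have "A *v (matrix_inv A *v axis j 1) = axis j 1"
    unfolding matrix_vector_mul_assoc matrix_inv_inverse(1)[OF assms] by simp
  then have "matrix_inv A *v axis j 1 = (\<chi> k. det (\<chi> a b. if b = k then axis j 1 $ a else A $ a $ b) / det A)"
    unfolding cramer[OF det] .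
  then have "(matrix_inv A *v axis j 1) $ k = adjugate A $ k $ j / det A"
    by (simp add: adjugate_def)
  then show ?thesis using det by (simp add: matrix_vector_mult_basis column_def)
qed

text \<open>The matrix \<open>htc_matrix D B v \<tau> \<Lambda> (phiG (\<Lambda>, \<Omega>))\<close> with denominators cleared row by row.\<close>

definition cleared_matrix :: "('n::finite \<times> 'n) set \<Rightarrow> ('n \<times> 'n) set \<Rightarrow> 'n \<Rightarrow> ('n \<Rightarrow> 'n)
    \<Rightarrow> real^'n^'n \<Rightarrow> real^'n^'n \<Rightarrow> real^'n^'n" where
  "cleared_matrix D B v \<tau> \<Lambda> \<Omega> = (\<chi> i j. if i \<in> pa D v then
     (if \<tau> i \<in> htr D B v then \<Omega> ** adjugate (mat 1 - \<Lambda>)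
      else transpose (adjugate (mat 1 - \<Lambda>)) ** \<Omega> ** adjugate (mat 1 - \<Lambda>)) $ \<tau> i $ j
     else of_bool (i = j))"

lemma det_cleared_matrix_eq_0_iff:
  fixes \<Lambda> :: "real^'n::finite^'n"
  assumes inv: "invertible (mat 1 - \<Lambda>)"
  shows "det (cleared_matrix D B v \<tau> \<Lambda> \<Omega>) = 0 \<longleftrightarrow> det (htc_matrix D B v \<tau> \<Lambda> (phiG (\<Lambda>, \<Omega>))) = 0"
proof -
  let ?d = "det (mat 1 - \<Lambda>)"
  have d: "?d \<noteq> 0" using inv by (simp add: invertible_det_nz)
  \<comment> \<open>One factor \<open>?d\<close> for each inverse of
    \<open>mat 1 - \<Lambda>\<close> occurring in row \<open>i\<close>.\<close>
  define s where "s i = (if i \<in> pa D v then if \<tau> i \<in> htr D B v then ?d else ?d * ?d else 1)" for i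
  have adj: "adjugate (mat 1 - \<Lambda>) = (\<chi> k j. ?d * matrix_inv (mat 1 - \<Lambda>) $ k $ j)"
    by (simp add: vec_eq_iff adjugate_eq[OF inv])
  have "cleared_matrix D B v \<tau> \<Lambda> \<Omega> = (\<chi> i. s i *s htc_matrix D B v \<tau> \<Lambda> (phiG (\<Lambda>, \<Omega>)) $ i)"
    unfolding vec_eq_iff cleared_matrix_def htc_matrix_def htc_entry_phiG[OF inv] adj
    by (simp add: s_def matrix_matrix_mult_def transpose_def sum_distrib_left sum_distrib_right mult_ac)
  then have "det (cleared_matrix D B v \<tau> \<Lambda> \<Omega>) = (\<Prod>i\<in>UNIV. s i) * det (htc_matrix D B v \<tau> \<Lambda> (phiG (\<Lambda>, \<Omega>)))"
    by (simp add: det_rows_mul)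
  moreover have "(\<Prod>i\<in>UNIV. s i) \<noteq> 0" using d by (simp add: s_def)
  ultimately show ?thesis by simp
qed

lemma poly_fun_matrix_mult:
  fixes A :: "('v \<Rightarrow> real) \<Rightarrow> real^'n::finite^'m" and C :: "('v \<Rightarrow> real) \<Rightarrow> real^'k^'n"
  assumes "\<And>i j. poly_fun (\<lambda>x. A x $ i $ j)" "\<And>i j. poly_fun (\<lambda>x. C x $ i $ j)"
  shows "poly_fun (\<lambda>x. (A x ** C x) $ i $ j)"
  unfolding matrix_matrix_mult_def by (simp add: poly_fun_sum pf_mult assms)

definition Lambda_of :: "(('n::finite \<times> 'n) + ('n \<times> 'n) \<Rightarrow> real) \<Rightarrow> real^'n^'n" where
  "Lambda_of x = (\<chi> i j. x (Inl (i,j)))"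

definition Omega_of :: "(('n::finite \<times> 'n) + ('n \<times> 'n) \<Rightarrow> real) \<Rightarrow> real^'n^'n" where
  "Omega_of x = (\<chi> i j. x (Inr (i,j)))"

lemma of_param_coords: "Lambda_of (param_coords p) = fst p" "Omega_of (param_coords p) = snd p"
  by (simp_all add: Lambda_of_def Omega_of_def param_coords_def vec_eq_iff)

lemma poly_fun_cleared_matrix:
  "poly_fun (\<lambda>x. det (cleared_matrix D B v \<tau> (Lambda_of x) (Omega_of x)))"
proof -
  have adj: "poly_fun (\<lambda>x. adjugate (mat 1 - Lambda_of x) $ k $ j)" for k j :: 'a
  proof -
    have "poly_fun (\<lambda>x. (mat 1 - Lambda_of x) $ a $ b)" for a b :: 'a
      by (simp add: Lambda_of_def poly_fun_diff pf_const pf_var)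
    then have *: "poly_fun (\<lambda>x. (\<chi> a b. if b = k then axis j 1 $ a else (mat 1 - Lambda_of x) $ a $ b) $ a $ b)" for a b
      by (cases "b = k") (simp_all add: pf_const del: vector_minus_component)
    show ?thesis using poly_fun_det[OF *] by (simp add: adjugate_def)
  qed
  have om: "poly_fun (\<lambda>x. Omega_of x $ k $ j)" for k j :: 'a
    by (simp add: Omega_of_def pf_var)
  have "poly_fun (\<lambda>x. transpose (adjugate (mat 1 - Lambda_of x)) $ k $ j)" for k j :: 'a
    using adj by (simp add: transpose_def)
  then have "poly_fun (\<lambda>x. cleared_matrix D B v \<tau> (Lambda_of x) (Omega_of x) $ i $ j)" for i j
    unfolding cleared_matrix_def
    by (cases "i \<in> pa D v"; cases "\<tau> i \<in> htr D B v") (simp_all add: poly_fun_matrix_mult adj om pf_const)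
  then show ?thesis by (rule poly_fun_det)
qed

text \<open>The half-trek system supplies an ambient point at which the determinant is nonzero. As
  \<open>\<Sigma>\<close> is only rational in the parameters, the certificate is the determinant of
  the cleared matrix, which has the same zeros in \<open>Theta D B\<close>.\<close>

lemma generically_det_htc_matrix:
  fixes D B :: "('n::finite \<times> 'n) set"
  assumes "sym B" and "Y \<inter> insert v (sib B v) = {}" and "half_trek_system_nsi D B Y (pa D v)" and "\<tau> ` pa D v = Y"
  shows "generically D B (\<lambda>p. det (htc_matrix D B v \<tau> (fst p) (phiG p)) \<noteq> 0)"
proof -
  obtain \<sigma> R where \<sigma>: "bij_betw \<sigma> Y (pa D v)" and R: "\<forall>y\<in>Y. is_half_trek D B y (\<sigma> y) (R y)"
    and disj: "\<forall>y\<in>Y. \<forall>y'\<in>Y. y \<noteq> y' \<longrightarrow> set (R y) \<inter> set (R y') = {}"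
    using assms(3) unfolding half_trek_system_nsi_def by (elim exE conjE)
  let ?C = "UNIV \<times> {q. \<exists>y\<in>Y - htr D B v. (q,y) \<in> D\<^sup>*}"
  have "\<exists>L S. witness D B ?C (Y \<union> (\<Union>y\<in>Y. set (R y))) Y ((\<lambda>y. last (R y)) ` Y) L S"
    by (rule half_trek_witness_exists[OF assms(1)]) (use R disj in \<open>auto simp: is_half_trek_def\<close>)
  then obtain L S where wit: "witness D B ?C (Y \<union> (\<Union>y\<in>Y. set (R y))) Y ((\<lambda>y. last (R y)) ` Y) L S"
    by (elim exE)
  have "(\<lambda>y. last (R y)) ` Y = \<sigma> ` Y"
    by (rule image_cong) (use R in \<open>auto simp: is_half_trek_def\<close>)
  then have P: "(\<lambda>y. last (R y)) ` Y = pa D v" using \<sigma> by (simp add: bij_betw_def)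
  define \<Lambda> \<Omega> :: "real^'n^'n" where "\<Lambda> = (\<chi> i j. L i j)" and "\<Omega> = (\<chi> i j. S i j)"
  note wit' = wit[unfolded P]
  note L = witnessD(1)[OF wit'] and S = witnessD(2)[OF wit'] and S' = witnessD(3)[OF wit']
    and inj = witnessD(4)[OF wit'] and sep = witnessD(5)[OF wit']
  have supp: "supported_on D \<Lambda>" using L unfolding supported_on_def supp_in_def \<Lambda>_def by auto
  have amb: "(\<Lambda>, \<Omega>) \<in> ambient D B"
    using supp S S' unfolding ambient_def supp_in_def \<Omega>_def by (auto simp: transpose_def)
  have inv: "invertible (mat 1 - \<Lambda>)"
    unfolding invertible_iff_ker
  proof (intro allI impI)
    fix x assume x: "(mat 1 - \<Lambda>) *v x = 0"
    have "x $ i = (\<Sum>j\<in>UNIV. L i j * x $ j)" for i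
      using one_minus_mult_vec[of \<Lambda> x i] unfolding x by (simp add: \<Lambda>_def)
    then have "x $ i = 0" for i by (rule inj)
    then show "x = 0" by (simp add: vec_eq_iff)
  qed
  have "det (htc_matrix D B v \<tau> \<Lambda> (phiG (\<Lambda>, \<Omega>))) \<noteq> 0"
    by (rule det_htc_matrix_nonzero[OF supp inv assms(4,2)]) (use sep in \<open>simp add: \<Lambda>_def \<Omega>_def\<close>)
  then have "det (cleared_matrix D B v \<tau> \<Lambda> \<Omega>) \<noteq> 0"
    by (simp add: det_cleared_matrix_eq_0_iff[OF inv])
  then have nz: "det (cleared_matrix D B v \<tau> (Lambda_of (param_coords (\<Lambda>, \<Omega>))) (Omega_of (param_coords (\<Lambda>, \<Omega>)))) \<noteq> 0"
    by (simp add: of_param_coords)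
  show ?thesis
    unfolding generically_def
  proof (intro exI[of _ "\<lambda>x. det (cleared_matrix D B v \<tau> (Lambda_of x) (Omega_of x))"] conjI ballI impI)
    show "poly_fun (\<lambda>x. det (cleared_matrix D B v \<tau> (Lambda_of x) (Omega_of x)))"
      by (rule poly_fun_cleared_matrix)
    show "\<exists>p\<in>ambient D B. det (cleared_matrix D B v \<tau> (Lambda_of (param_coords p)) (Omega_of (param_coords p))) \<noteq> 0"
      using amb nz by (rule bexI[rotated])
    fix p assume p: "p \<in> Theta D B"
      and "det (cleared_matrix D B v \<tau> (Lambda_of (param_coords p)) (Omega_of (param_coords p))) \<noteq> 0"
    moreover have "invertible (mat 1 - fst p)" using p by (auto simp: Theta_def)
    ultimately show "det (htc_matrix D B v \<tau> (fst p) (phiG p)) \<noteq> 0"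
      using det_cleared_matrix_eq_0_iff[of "fst p" D B v \<tau> "snd p"] by (simp add: of_param_coords)
  qed
qed

section \<open>Recovery of the parameters\<close>

text \<open>Cramer's rule solves \<open>htc_system\<close> for column \<open>v\<close>. Its
  coefficients are generically rational since the only columns of \<open>\<Lambda>\<close> that
  enter are those of \<open>Y \<inter> htr D B v\<close>.\<close>

lemma gen_rat_Lambda_step:
  fixes D B :: "('n::finite \<times> 'n) set"
  assumes "sym B" "HTC D B Y v"
    and IH: "\<And>y k. y \<in> Y \<inter> htr D B v \<Longrightarrow> gen_rat D B (\<lambda>p. fst p $ k $ y)"
  shows "gen_rat D B (\<lambda>p. fst p $ k $ v)"
proof -
  have Y: "Y \<inter> insert v (sib B v) = {}" and sys: "half_trek_system_nsi D B Y (pa D v)"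
    using assms(2) unfolding HTC_def by auto
  from sys obtain \<sigma> where "bij_betw \<sigma> Y (pa D v)" unfolding half_trek_system_nsi_def by (elim exE conjE)
  \<comment> \<open>\<open>\<tau>\<close> inverts the pairing of sources with targets, so that the
    equations are indexed by the parents and the system is square.\<close>
  then obtain \<tau> where \<tau>: "\<tau> ` pa D v = Y" by (metis bij_betw_def bij_betw_inv)
  define K where "K p = htc_matrix D B v \<tau> (fst p) (phiG p)" for p
  define b where "b p = htc_vector D B v \<tau> (fst p) (phiG p)" for p
  have entry: "gen_rat D B (\<lambda>p. htc_entry D B v (fst p) (phiG p) (\<tau> i) j)" if "i \<in> pa D v" for i j
  proof (cases "\<tau> i \<in> htr D B v")
    case True
    then have "gen_rat D B (\<lambda>p. fst p $ k $ \<tau> i)" for k using IH that \<tau> by blast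
    with True show ?thesis unfolding htc_entry_def
      by (simp add: gen_rat_diff gen_rat_Sigma gen_rat_sum gen_rat_mult)
  qed (simp add: htc_entry_def gen_rat_Sigma)
  have K: "gen_rat D B (\<lambda>p. K p $ i $ j)" for i j
    by (cases "i \<in> pa D v") (simp_all add: K_def htc_matrix_def entry gen_rat_const)
  have b: "gen_rat D B (\<lambda>p. b p $ i)" for i
    by (cases "i \<in> pa D v") (simp_all add: b_def htc_vector_def entry gen_rat_const)
  have gen: "generically D B (\<lambda>p. det (K p) \<noteq> 0)"
    unfolding K_def by (rule generically_det_htc_matrix[OF assms(1) Y sys \<tau>])
  show ?thesis
  proof (rule gen_rat_cong)
    show "gen_rat D B (\<lambda>p. det (\<chi> i j. if j = k then b p $ i else K p $ i $ j) / det (K p))"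
    proof (intro gen_rat_divide gen_rat_det K gen)
      fix i j
      show "gen_rat D B (\<lambda>p. (\<chi> i j. if j = k then b p $ i else K p $ i $ j) $ i $ j)"
        by (cases "j = k") (simp_all add: b K)
    qed
    show "generically D B (\<lambda>p. det (\<chi> i j. if j = k then b p $ i else K p $ i $ j) / det (K p) = fst p $ k $ v)"
    proof (rule generically_mono[OF generically_conj[OF gen generically_Theta]])
      fix p assume p: "det (K p) \<noteq> 0 \<and> p \<in> Theta D B"
      have "K p *v column v (fst p) = b p"
        using htc_system[of "fst p" "snd p" D B v \<tau>] p assms(1) Y \<tau> unfolding K_def b_def by fastforce
      then have "column v (fst p) = (\<chi> k. det (\<chi> i j. if j = k then b p $ i else K p $ i $ j) / det (K p))"
        using cramer p by blast
      then have "column v (fst p) $ k = det (\<chi> i j. if j = k then b p $ i else K p $ i $ j) / det (K p)"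
        by simp
      then show "det (\<chi> i j. if j = k then b p $ i else K p $ i $ j) / det (K p) = fst p $ k $ v"
        by (simp add: column_def)
    qed
  qed
qed

lemma Omega_eq:
  assumes "invertible (mat 1 - \<Lambda>)"
  shows "transpose (mat 1 - \<Lambda>) ** phiG (\<Lambda>, \<Omega>) ** (mat 1 - \<Lambda>) = \<Omega>"
proof -
  let ?M = "matrix_inv (mat 1 - \<Lambda>)"
  have "transpose (mat 1 - \<Lambda>) ** phiG (\<Lambda>, \<Omega>) ** (mat 1 - \<Lambda>) =
      transpose (?M ** (mat 1 - \<Lambda>)) ** \<Omega> ** (?M ** (mat 1 - \<Lambda>))"
    by (simp add: phiG_def matrix_mul_assoc matrix_transpose_mul)
  also have "\<dots> = \<Omega>" by (simp add: matrix_inv_inverse(2)[OF assms] transpose_mat)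
  finally show ?thesis .
qed

theorem mainTheorem1:
  fixes D B :: "('n::finite \<times> 'n) set" and Y :: "'n \<Rightarrow> 'n set"
    and prec :: "'n rel"
  assumes "mixed_graph D B"
    and "\<forall>v. HTC D B (Y v) v"
    and "strict_linear_order prec"
    and "\<forall>v w. w \<in> Y v \<inter> htr D B v \<longrightarrow> (w, v) \<in> prec"
  shows "rationally_identifiable D B"
proof -
  have B: "sym B" using assms(1) by (simp add: mixed_graph_def)
  \<comment> \<open>A strict order on a finite type is well-founded, so the columns can be recovered
    by induction along \<open>prec\<close>.\<close>
  have "wf prec"
    using assms(3) by (intro finite_acyclic_wf) (auto simp: strict_linear_order_on_def acyclic_irrefl)
  then have \<Lambda>: "gen_rat D B (\<lambda>p. fst p $ k $ v)" for k v
  proof (induction v arbitrary: k)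
    case (less v)
    show ?case
      by (rule gen_rat_Lambda_step[OF B]) (use assms(2,4) less.IH in blast)+
  qed
  \<comment> \<open>With \<open>\<Lambda>\<close> known, \<open>\<Omega>\<close> is read off from
    \<open>(I - \<Lambda>)\<^sup>T \<Sigma> (I - \<Lambda>)\<close>.\<close>
  have \<Omega>: "gen_rat D B (\<lambda>p. snd p $ i $ j)" for i j
  proof (rule gen_rat_cong)
    have M: "gen_rat D B (\<lambda>p. (mat 1 - fst p) $ i $ j)" for i j
      by (simp add: gen_rat_diff gen_rat_const \<Lambda>)
    show "gen_rat D B (\<lambda>p. (transpose (mat 1 - fst p) ** phiG p ** (mat 1 - fst p)) $ i $ j)"
      using M by (simp add: matrix_matrix_mult_def transpose_def gen_rat_sum gen_rat_mult gen_rat_Sigma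
          del: vector_minus_component)
    show "generically D B (\<lambda>p. (transpose (mat 1 - fst p) ** phiG p ** (mat 1 - fst p)) $ i $ j = snd p $ i $ j)"
      by (rule generically_mono[OF generically_Theta]) (auto simp: Theta_def Omega_eq)
  qed
  show ?thesis
  proof (rule rationally_identifiable_if_gen_rat)
    fix k
    show "gen_rat D B (\<lambda>p. param_coords p k)"
      by (cases k) (auto simp: param_coords_def \<Lambda> \<Omega> split: prod.split)
  qed
qed

end
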